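(* Let $n\ge1$ and $m\ge0$ be integers and $\nu>0$. For $R>0$ let $\alpha=\nu R^2$ and let $K_R$ be the reproducing kernel of the weighted Bergman-Dirichlet space $\mathcal{A}^{2,\alpha}_m(\mathbb{B}^n_R)$ on the ball $\mathbb{B}^n_R=\{z\in\mathbb{C}^n:|z|<R\}$, i.e. the space of holomorphic $f$ on $\mathbb{B}^n_R$ with $$\|f\|_{\alpha,m,R}^2:=\|f_{1,m}\|_{\alpha,R}^2+\sum_{|l|=m}\frac{m!}{l!}\|D^lf\|_{\alpha,R}^2<\infty,\qquad \|g\|_{\alpha,R}^2=\int_{\mathbb{B}^n_R}|g(z)|^2\Big(1-\frac{|z|^2}{R^2}\Big)^{\alpha}d\lambda(z).$$ Let $K$ be the reproducing kernel of the Bargmann-Dirichlet space $\mathcal{F}^{2,\nu}_m(\mathbb{C}^n)$ of entire functions $f$ with $\|f\|_{\nu,m}^2:=\|f_{1,m}\|_\nu^2+\sum_{|l|=m}\frac{m!}{l!}\|D^lf\|_\nu^2<\infty$, $\|g\|_\nu^2=\int_{\mathbb{C}^n}|g(z)|^2e^{-\nu|z|^2}d\lambda(z)$. Then $K_R(z,w)\to K(z,w)$ as $R\to+\infty$, pointwise for every $(z,w)\in\mathbb{C}^n\times\mathbb{C}^n$ and uniformly on compact subsets of $\mathbb{C}^n\times\mathbb{C}^n$ (for a compact set, $K_R$ being defined on it once $R$ is large enough).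
   Context: $\langle z,w\rangle=\sum_j z_j\overline{w_j}$, $|z|=\sqrt{\langle z,z\rangle}$, $d\lambda$ is Lebesgue measure on $\mathbb{C}^n$. Multi-index notation: for $l=(l_1,\dots,l_n)$ nonnegative integers, $|l|=\sum l_j$, $l!=\prod l_j!$, $z^l=\prod z_j^{l_j}$, $D^l=\frac{\partial^{|l|}}{\partial z_1^{l_1}\cdots\partial z_n^{l_n}}$. For $f=\sum_pa_pz^p$, $f_{1,m}=\sum_{|p|<m}a_pz^p$. Both spaces are Hilbert spaces with the inner products associated with the given norms, and the reproducing kernel $K_X(z,w)$ of such a space $X$ is the function with $K_X(\cdot,w)\in X$ and $f(w)=\langle f,K_X(\cdot,w)\rangle_X$ for all $f\in X$. *)

theory Defs
  imports "HOL-Analysis.Analysis"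
begin

text \<open>Points of C^n are modelled as complex ^ 'n for a finite index type 'n (n = CARD('n) >= 1).
  Multi-indices are functions 'n => nat.\<close>

definition holo_on :: "(complex ^ 'n::finite) set \<Rightarrow> (complex ^ 'n \<Rightarrow> complex) \<Rightarrow> bool" where
  "holo_on U f \<longleftrightarrow> open U \<and> (\<forall>z\<in>U. \<exists>f'. (f has_derivative f') (at z) \<and> (\<forall>c v. f' (c *s v) = c * f' v))"

definition cpartial :: "'n::finite \<Rightarrow> (complex ^ 'n \<Rightarrow> complex) \<Rightarrow> complex ^ 'n \<Rightarrow> complex" where
  "cpartial j f z = deriv (\<lambda>t. f (\<chi> k. if k = j then t else z $ k)) (z $ j)"

definition index_list :: "'n::finite list" where
  "index_list = (SOME xs. distinct xs \<and> set xs = UNIV)"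

definition Dmulti :: "('n::finite \<Rightarrow> nat) \<Rightarrow> (complex ^ 'n \<Rightarrow> complex) \<Rightarrow> complex ^ 'n \<Rightarrow> complex" where
  "Dmulti l f = foldr (\<lambda>j g. (cpartial j ^^ l j) g) index_list f"

definition mabs :: "('n::finite \<Rightarrow> nat) \<Rightarrow> nat" where
  "mabs l = (\<Sum>j\<in>UNIV. l j)"

definition mfact :: "('n::finite \<Rightarrow> nat) \<Rightarrow> real" where
  "mfact l = (\<Prod>j\<in>UNIV. fact (l j))"

definition mpow :: "complex ^ 'n::finite \<Rightarrow> ('n \<Rightarrow> nat) \<Rightarrow> complex" where
  "mpow z l = (\<Prod>j\<in>UNIV. (z $ j) ^ (l j))"

definition taylor_part :: "nat \<Rightarrow> (complex ^ 'n::finite \<Rightarrow> complex) \<Rightarrow> complex ^ 'n \<Rightarrow> complex" where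
  "taylor_part m f z = (\<Sum>p\<in>{p. mabs p < m}. Dmulti p f 0 / of_real (mfact p) * mpow z p)"

definition wnorm2 :: "(complex ^ 'n::finite) set \<Rightarrow> (complex ^ 'n \<Rightarrow> real) \<Rightarrow> (complex ^ 'n \<Rightarrow> complex) \<Rightarrow> ennreal" where
  "wnorm2 U \<omega> g = (\<integral>\<^sup>+ z. ennreal ((cmod (g z))\<^sup>2 * \<omega> z) * indicator U z \<partial>lborel)"

definition dnorm2 :: "(complex ^ 'n::finite) set \<Rightarrow> (complex ^ 'n \<Rightarrow> real) \<Rightarrow> nat \<Rightarrow> (complex ^ 'n \<Rightarrow> complex) \<Rightarrow> ennreal" where
  "dnorm2 U \<omega> m f = wnorm2 U \<omega> (taylor_part m f)
     + (\<Sum>l\<in>{l. mabs l = m}. ennreal (fact m / mfact l) * wnorm2 U \<omega> (Dmulti l f))"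

definition dspace :: "(complex ^ 'n::finite) set \<Rightarrow> (complex ^ 'n \<Rightarrow> real) \<Rightarrow> nat \<Rightarrow> (complex ^ 'n \<Rightarrow> complex) set" where
  "dspace U \<omega> m = {f. holo_on U f \<and> dnorm2 U \<omega> m f < \<infinity>}"

definition winner :: "(complex ^ 'n::finite) set \<Rightarrow> (complex ^ 'n \<Rightarrow> real) \<Rightarrow> (complex ^ 'n \<Rightarrow> complex) \<Rightarrow> (complex ^ 'n \<Rightarrow> complex) \<Rightarrow> complex" where
  "winner U \<omega> f g = (LINT z:U|lborel. f z * cnj (g z) * of_real (\<omega> z))"

definition dinner :: "(complex ^ 'n::finite) set \<Rightarrow> (complex ^ 'n \<Rightarrow> real) \<Rightarrow> nat \<Rightarrow> (complex ^ 'n \<Rightarrow> complex) \<Rightarrow> (complex ^ 'n \<Rightarrow> complex) \<Rightarrow> complex" where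
  "dinner U \<omega> m f g = winner U \<omega> (taylor_part m f) (taylor_part m g)
     + (\<Sum>l\<in>{l. mabs l = m}. of_real (fact m / mfact l) * winner U \<omega> (Dmulti l f) (Dmulti l g))"

definition is_repr_kernel :: "(complex ^ 'n::finite) set \<Rightarrow> (complex ^ 'n \<Rightarrow> real) \<Rightarrow> nat \<Rightarrow> (complex ^ 'n \<Rightarrow> complex ^ 'n \<Rightarrow> complex) \<Rightarrow> bool" where
  "is_repr_kernel U \<omega> m K \<longleftrightarrow>
     (\<forall>w\<in>U. (\<lambda>z. K z w) \<in> dspace U \<omega> m \<and> (\<forall>f\<in>dspace U \<omega> m. f w = dinner U \<omega> m f (\<lambda>z. K z w)))"

end

theory Submission
  imports Defs "HOL-Complex_Analysis.Cauchy_Integral_Formula" "HOL-Real_Asymp.Real_Asymp"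
begin

text \<open>The weights increase with \<open>R\<close> to the Gaussian weight, so for \<open>R \<le> S\<close> restriction is
  norm-decreasing from the space of radius \<open>S\<close> to that of radius \<open>R\<close>. Expanding
  \<open>\<parallel>K\<^sub>S(\<cdot>,w) - K\<^sub>R(\<cdot>,w)\<parallel>\<^sub>R\<^sup>2\<close> with the reproducing property gives
  \<open>\<bar>K\<^sub>S(z,w) - K\<^sub>R(z,w)\<bar>\<^sup>2 \<le> (K\<^sub>R(w,w) - K\<^sub>S(w,w)) K\<^sub>R(z,z)\<close>, also for the limit kernel \<open>K\<close> in place of \<open>K\<^sub>S\<close>.
  The diagonal values decrease and \<open>K\<^sub>R(z,z)\<close> is locally bounded, so \<open>K\<^sub>R(\<cdot>,w)\<close> converges locally uniformly
  to a holomorphic \<open>k\<close>; Fatou's lemma and the reproducing property of \<open>K\<close> give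
  \<open>lim K\<^sub>R(w,w) \<le> K(w,w)\<close>, whence pointwise convergence. Cauchy estimates make the \<open>K\<^sub>R\<close> equi-Lipschitz
  on compact sets, which yields uniformity.\<close>

section \<open>Holomorphic functions of several variables\<close>

text \<open>Neither kernel is ever computed: there is no orthogonal basis and no series, only
  inequalities between squared norms and the reproducing identity. The obstacle is that the norm
  sees a function only through its Taylor polynomial of degree below \<open>m\<close> and its
  derivatives of order \<open>m\<close>. Local boundedness of \<open>K_R(z,z)\<close>, that is, of
  evaluation, must be recovered from these: the mean value inequality bounds both kinds of pieces on
  a smaller ball, Cauchy estimates turn the bound on the polynomial into bounds on derivatives at 0,
  and \<open>m\<close> integrations from 0 give the function itself. For the same reason Fatou's
  lemma needs convergence of derivatives and not only of values, hence Weierstrass's theorem. Fatou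
  cannot be avoided: monotonicity alone gives \<open>lim K_R(w,w) >= K(w,w)\<close>, and the
  opposite inequality needs the limit to be a member of the Gaussian space. Several-variable facts
  are reduced to one variable by restriction to complex lines \<open>z + s *s v\<close>.\<close>

lemma norm_vector_smult: "norm (c *s v) = cmod c * norm (v :: complex ^ 'n::finite)"
  by (simp add: norm_vec_def norm_mult L2_set_right_distrib)

lemma bounded_linear_smult_left: "bounded_linear (\<lambda>c. c *s (v :: complex ^ 'n::finite))"
  by (rule bounded_linear_intro[where K = "norm v"])
     (simp_all add: vec_eq_iff norm_vector_smult algebra_simps)

lemma has_derivative_affine_line:
  "((\<lambda>s. z + s *s v) has_derivative (\<lambda>s. s *s (v :: complex ^ 'n::finite))) (at t)"
  using has_derivative_add[OF has_derivative_const[of z]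
      bounded_linear.has_derivative[OF bounded_linear_smult_left has_derivative_ident]]
  by simp

lemma continuous_on_affine_line: "continuous_on A (\<lambda>s. z + s *s (v :: complex ^ 'n::finite))"
  by (intro continuous_at_imp_continuous_on ballI has_derivative_continuous[OF has_derivative_affine_line])

text \<open>\<open>cpartial\<close> varies one coordinate; rewritten as motion along the complex
  line through \<open>z\<close> in direction \<open>axis j 1\<close>, it becomes a directional
  derivative, accessible to one-variable theory.\<close>

lemma update_eq_line:
  "(\<chi> k. if k = j then t else z $ k) = z + (t - z $ j) *s axis j (1::complex)"
  by (simp add: vec_eq_iff axis_def)

lemma holo_on_open: "holo_on U f \<Longrightarrow> open U"
  by (simp add: holo_on_def)

text \<open>Replaces the existentially quantified derivative of \<open>holo_on\<close> by a
  canonical one, so that later arguments can name it as a function of the point.\<close>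

lemma holo_on_has_derivative:
  assumes "holo_on U f" "z \<in> U"
  shows "(f has_derivative frechet_derivative f (at z)) (at z)"
    and "frechet_derivative f (at z) (c *s v) = c * frechet_derivative f (at z) v"
proof -
  obtain f' where f': "(f has_derivative f') (at z)" "\<And>c v. f' (c *s v) = c * f' v"
    using assms unfolding holo_on_def by blast
  have "f' = frechet_derivative f (at z)" by (rule frechet_derivative_at[OF f'(1)])
  then show "(f has_derivative frechet_derivative f (at z)) (at z)"
    "frechet_derivative f (at z) (c *s v) = c * frechet_derivative f (at z) v"
    using f' by auto
qed

lemma holo_on_subset: "holo_on U f \<Longrightarrow> open V \<Longrightarrow> V \<subseteq> U \<Longrightarrow> holo_on V f"
  by (auto simp: holo_on_def)

lemma holo_on_local:
  assumes "open U" "\<And>z. z \<in> U \<Longrightarrow> \<exists>V. z \<in> V \<and> holo_on V f"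
  shows "holo_on U f"
  using assms unfolding holo_on_def by blast

lemma holo_on_imp_continuous_on: "holo_on U f \<Longrightarrow> continuous_on U f"
  by (meson continuous_at_imp_continuous_on has_derivative_continuous holo_on_def)

text \<open>Complex homogeneity makes the derivative, applied to \<open>s *s v\<close>,
  multiplication by one complex number; this turns real differentiability into holomorphy along
  complex lines.\<close>

lemma holo_on_line:
  assumes "holo_on U f" "z + t *s v \<in> U"
  shows "((\<lambda>s. f (z + s *s v)) has_field_derivative frechet_derivative f (at (z + t *s v)) v) (at t)"
  unfolding has_field_derivative_def
  using has_derivative_compose[OF has_derivative_affine_line holo_on_has_derivative(1)[OF assms]]
  by (simp add: holo_on_has_derivative(2)[OF assms] mult_commute_abs)

lemma holomorphic_on_line:
  assumes "holo_on U f" "\<And>t. t \<in> A \<Longrightarrow> z + t *s v \<in> U"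
  shows "(\<lambda>s. f (z + s *s v)) holomorphic_on A"
  unfolding holomorphic_on_def field_differentiable_def
  using holo_on_line[OF assms(1)] assms(2) has_field_derivative_at_within by blast

lemma cpartial_eq_frechet:
  assumes "holo_on U f" "z \<in> U"
  shows "cpartial j f z = frechet_derivative f (at z) (axis j 1)"
proof -
  have "((\<lambda>s. f (z + s *s axis j 1)) has_field_derivative frechet_derivative f (at z) (axis j 1)) (at 0)"
    using holo_on_line[OF assms(1), of z 0 "axis j 1"] assms(2) by simp
  then have "((\<lambda>t. f (z + (t - z $ j) *s axis j 1)) has_field_derivative
      frechet_derivative f (at z) (axis j 1) * 1) (at (z $ j))"
    by (intro DERIV_chain2[where f = "\<lambda>s. f (z + s *s axis j 1)" and g = "\<lambda>t. t - z $ j"])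
       (auto intro!: derivative_eq_intros)
  then show ?thesis
    unfolding cpartial_def update_eq_line by (simp add: DERIV_imp_deriv)
qed

text \<open>Functions are total, while identities between them are known on \<open>U\<close> only. A
  derivative at \<open>z\<close> sees just a neighbourhood of \<open>z\<close>, and the open set
  \<open>U\<close> pulls back to an open set of parameters \<open>t\<close>.\<close>

lemma cpartial_cong:
  assumes "open U" "z \<in> U" "\<And>z. z \<in> U \<Longrightarrow> f z = g z"
  shows "cpartial j f z = cpartial j g z"
  unfolding cpartial_def update_eq_line
proof (rule deriv_cong_ev)
  have c: "continuous_on UNIV (\<lambda>t. z + (t - z $ j) *s axis j (1::complex))"
    using continuous_on_compose2[OF continuous_on_affine_line[of UNIV z "axis j 1"], of UNIV "\<lambda>t. t - z $ j"]
    by (simp add: continuous_on_diff)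
  have "open ((\<lambda>t. z + (t - z $ j) *s axis j (1::complex)) -` U)"
    using c assms(1) by (simp add: continuous_on_open_vimage)
  then have "\<forall>\<^sub>F t in nhds (z $ j). t \<in> (\<lambda>t. z + (t - z $ j) *s axis j (1::complex)) -` U"
    by (rule eventually_nhds_in_open) (use assms(2) in simp)
  then show "\<forall>\<^sub>F t in nhds (z $ j). f (z + (t - z $ j) *s axis j 1) = g (z + (t - z $ j) *s axis j 1)"
    by eventually_elim (use assms(3) in auto)
qed simp

text \<open>The one-variable Cauchy estimate for \<open>f (z + t *s v)\<close> as a function of
  \<open>t\<close>, on the disc of radius \<open>r / norm v\<close>, which the line carries into
  \<open>cball z r\<close>.\<close>

lemma frechet_Cauchy_bound:
  assumes "holo_on U f" "cball z r \<subseteq> U" "0 < r" "\<And>x. x \<in> cball z r \<Longrightarrow> norm (f x) \<le> M"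
  shows "norm (frechet_derivative f (at z) v) \<le> M / r * norm v"
proof (cases "v = 0")
  case True
  have "z \<in> U" using assms by auto
  then have "linear (frechet_derivative f (at z))"
    using holo_on_has_derivative(1)[OF assms(1)] has_derivative_linear by blast
  then show ?thesis using True by (simp add: linear_0)
next
  case False
  define g where "g t = f (z + t *s v)" for t
  define \<rho> where "\<rho> = r / norm v"
  have \<rho>: "\<rho> > 0" using False assms by (simp add: \<rho>_def)
  have in_cball: "z + t *s v \<in> cball z r" if "t \<in> cball 0 \<rho>" for t
    using that False by (simp add: \<rho>_def norm_vector_smult dist_norm pos_le_divide_eq)
  have hol: "g holomorphic_on cball 0 \<rho>"
    unfolding g_def by (rule holomorphic_on_line[OF assms(1)]) (use in_cball assms(2) in blast)
  have "norm ((deriv ^^ 1) g 0) \<le> fact 1 * M / \<rho> ^ 1"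
  proof (rule Cauchy_inequality)
    show "g holomorphic_on ball 0 \<rho>" using hol by (rule holomorphic_on_subset) auto
    show "continuous_on (cball 0 \<rho>) g" using hol by (rule holomorphic_on_imp_continuous_on)
    show "norm (g x) \<le> M" if "norm (0 - x) = \<rho>" for x
      unfolding g_def using assms(4) in_cball[of x] that by (auto simp: dist_norm)
  qed (use \<rho> in auto)
  moreover have "deriv g 0 = frechet_derivative f (at z) v"
    using holo_on_line[OF assms(1), of z 0 v] assms(2,3) unfolding g_def
    by (simp add: DERIV_imp_deriv subset_iff)
  ultimately show ?thesis using False by (simp add: \<rho>_def field_simps)
qed

section \<open>Locally uniform limits of holomorphic functions\<close>

definition loc_unif :: "(complex ^ 'n::finite) set \<Rightarrow> (nat \<Rightarrow> complex ^ 'n \<Rightarrow> complex) \<Rightarrow> (complex ^ 'n \<Rightarrow> complex) \<Rightarrow> bool" where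
  "loc_unif U f g \<longleftrightarrow> (\<forall>z\<in>U. \<exists>r>0. ball z r \<subseteq> U \<and> uniform_limit (ball z r) f g sequentially)"

lemma loc_unif_pointwise: "loc_unif U f g \<Longrightarrow> z \<in> U \<Longrightarrow> (\<lambda>n. f n z) \<longlonglongrightarrow> g z"
proof -
  assume "loc_unif U f g" "z \<in> U"
  then obtain r where "r > 0" "uniform_limit (ball z r) f g sequentially"
    unfolding loc_unif_def by blast
  then show ?thesis by (simp add: tendsto_uniform_limitI[where S = "ball z r"])
qed

lemma loc_unif_uniform_limit:
  assumes "open U" "uniform_limit U f g sequentially"
  shows "loc_unif U f g"
  unfolding loc_unif_def using assms
  by (meson open_contains_ball uniform_limit_on_subset)

text \<open>Weierstrass's theorem on a ball, at the price of half the radius: Cauchy estimates for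
  \<open>f m - f n\<close> need room around each point. They make the derivatives uniformly Cauchy
  on the smaller ball, where the real theorem on differentiating a sequence applies.\<close>

lemma loc_unif_holo_local:
  assumes holo: "\<And>n. holo_on (ball a (2 * r)) (f n)" and r: "r > 0"
    and lim: "uniform_limit (ball a (2 * r)) f g sequentially"
  shows "holo_on (ball a r) g"
    and "uniform_limit (ball a r) (\<lambda>n. cpartial j (f n)) (cpartial j g) sequentially"
proof -
  let ?S = "ball a r"
  let ?D = "\<lambda>n x. frechet_derivative (f n) (at x)"
  have S: "?S \<subseteq> ball a (2 * r)" using r by auto
  have der: "(f n has_derivative ?D n x) (at x)" if "x \<in> ?S" for n x
    using holo_on_has_derivative(1)[OF holo] that S by blast
  have Dlin: "?D n x (c *s v) = c * ?D n x v" if "x \<in> ?S" for n x c v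
    using holo_on_has_derivative(2)[OF holo] that S by blast
  have cau: "\<exists>N. \<forall>m\<ge>N. \<forall>n\<ge>N. \<forall>x\<in>?S. \<forall>h. norm (?D m x h - ?D n x h) \<le> e * norm h" if "e > 0" for e
  proof -
    \<comment> \<open>Two functions within \<open>d\<close> of \<open>g\<close> differ by at most
      \<open>2 * d\<close>, and the Cauchy estimate on balls of radius \<open>r / 2\<close>
      multiplies this by \<open>2 / r\<close>; the result is exactly \<open>e\<close>.\<close>
    define d where "d = e * r / 4"
    have "d > 0" using that r by (simp add: d_def)
    then have "\<forall>\<^sub>F n in sequentially. \<forall>x\<in>ball a (2*r). dist (f n x) (g x) < d"
      using lim by (simp add: uniform_limit_iff)
    then obtain N where N: "\<And>n x. n \<ge> N \<Longrightarrow> x \<in> ball a (2*r) \<Longrightarrow> dist (f n x) (g x) < d"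
      unfolding eventually_sequentially by blast
    have "norm (?D m x h - ?D n x h) \<le> e * norm h" if "m \<ge> N" "n \<ge> N" "x \<in> ?S" for m n x h
    proof -
      have sub: "cball x (r/2) \<subseteq> ball a (2*r)"
      proof
        fix y assume "y \<in> cball x (r/2)"
        then have "dist a y < 2 * r" using \<open>x \<in> ?S\<close> r dist_triangle[of a y x] by simp
        then show "y \<in> ball a (2*r)" by simp
      qed
      define k where "k y = f m y - f n y" for y
      have dk: "(k has_derivative (\<lambda>h. ?D m y h - ?D n y h)) (at y)" if "y \<in> ball a (2*r)" for y
        unfolding k_def by (intro has_derivative_diff holo_on_has_derivative(1)[OF holo that])
      have hk: "holo_on (ball a (2*r)) k"
        unfolding holo_on_def
      proof (intro conjI ballI)
        fix z assume z: "z \<in> ball a (2*r)"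
        show "\<exists>f'. (k has_derivative f') (at z) \<and> (\<forall>c v. f' (c *s v) = c * f' v)"
          by (rule exI[of _ "\<lambda>h. ?D m z h - ?D n z h"])
             (simp add: dk[OF z] holo_on_has_derivative(2)[OF holo z] algebra_simps)
      qed simp
      have kb: "norm (k y) \<le> 2 * d" if "y \<in> cball x (r/2)" for y
        using N[of m y] N[of n y] that sub \<open>m \<ge> N\<close> \<open>n \<ge> N\<close> norm_triangle_sub
        unfolding k_def dist_norm
        by (smt (verit, best) dist_norm dist_triangle2 subset_iff)
      have "norm (frechet_derivative k (at x) h) \<le> 2 * d / (r/2) * norm h"
        by (rule frechet_Cauchy_bound[OF hk sub _ kb]) (use r in auto)
      moreover have "frechet_derivative k (at x) = (\<lambda>h. ?D m x h - ?D n x h)"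
        using frechet_derivative_at[OF dk[of x]] \<open>x \<in> ?S\<close> S by auto
      ultimately show ?thesis using r by (simp add: d_def)
    qed
    then show ?thesis by blast
  qed
  have conv: "convergent (\<lambda>n. ?D n x h)" if "x \<in> ?S" for x h
  proof (rule Cauchy_convergent, rule CauchyI)
    fix e :: real assume "e > 0"
    \<comment> \<open>Adding 1 covers \<open>h = 0\<close> and makes the final inequality
      strict.\<close>
    then have pos: "e / (norm h + 1) > 0" by (simp add: add_nonneg_pos)
    then obtain N where N: "\<And>m n. m \<ge> N \<Longrightarrow> n \<ge> N \<Longrightarrow> norm (?D m x h - ?D n x h) \<le> e / (norm h + 1) * norm h"
      using cau[OF pos] \<open>x \<in> ?S\<close> by metis
    have "e / (norm h + 1) * norm h < e"
    proof -
      have "e / (norm h + 1) * norm h < e / (norm h + 1) * (norm h + 1)"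
        by (intro mult_strict_left_mono) (use pos in auto)
      also have "\<dots> = e" using norm_ge_zero[of h] by (simp add: add_nonneg_pos less_imp_neq[symmetric])
      finally show ?thesis .
    qed
    then show "\<exists>M. \<forall>m\<ge>M. \<forall>n\<ge>M. norm (?D m x h - ?D n x h) < e"
      by (intro exI[of _ N] allI impI le_less_trans[OF N])
  qed
  define G where "G x h = lim (\<lambda>n. ?D n x h)" for x h
  have Glim: "(\<lambda>n. ?D n x h) \<longlonglongrightarrow> G x h" if "x \<in> ?S" for x h
    using conv[OF that] unfolding G_def by (simp add: convergent_LIMSEQ_iff)
  have unif: "\<forall>\<^sub>F n in sequentially. \<forall>x\<in>?S. \<forall>h. norm (?D n x h - G x h) \<le> e * norm h" if "e > 0" for e
  proof -
    obtain N where N: "\<And>m n x h. m \<ge> N \<Longrightarrow> n \<ge> N \<Longrightarrow> x \<in> ?S \<Longrightarrow> norm (?D m x h - ?D n x h) \<le> e * norm h"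
      using cau[OF \<open>e > 0\<close>] by metis
    have "norm (?D n x h - G x h) \<le> e * norm h" if "n \<ge> N" "x \<in> ?S" for n x h
    proof (rule LIMSEQ_le_const2)
      show "(\<lambda>m. norm (?D n x h - ?D m x h)) \<longlonglongrightarrow> norm (?D n x h - G x h)"
        by (intro tendsto_intros Glim that)
      show "\<exists>M. \<forall>m\<ge>M. norm (?D n x h - ?D m x h) \<le> e * norm h"
        by (intro exI[of _ N] allI impI N that)
    qed
    then show ?thesis unfolding eventually_sequentially by (intro exI[of _ N]) simp
  qed
  have glim: "(\<lambda>n. f n x) \<longlonglongrightarrow> g x" if "x \<in> ?S" for x
    using tendsto_uniform_limitI[OF lim, of x] that S by blast
  have "\<exists>g0. \<forall>x\<in>?S. (\<lambda>n. f n x) \<longlonglongrightarrow> g0 x \<and> (g0 has_derivative G x) (at x within ?S)"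
    by (rule has_derivative_sequence[where f' = ?D and ?x0.0 = a and l = "g a"])
       (use r in \<open>auto intro: glim has_derivative_at_withinI[OF der] unif simp del: mem_ball\<close>)
  \<comment> \<open>The differentiation theorem supplies a limit function of its own; uniqueness of
    limits identifies it with \<open>g\<close> on the ball.\<close>
  then obtain g0 where "\<forall>x\<in>?S. (\<lambda>n. f n x) \<longlonglongrightarrow> g0 x \<and> (g0 has_derivative G x) (at x within ?S)" ..
  note g0 = bspec[OF this]
  have Gder: "(g has_derivative G x) (at x)" if x: "x \<in> ?S" for x
  proof -
    have "(g0 has_derivative G x) (at x)"
      using g0[OF x] at_within_open[OF x open_ball] by metis
    moreover have "g0 y = g y" if "y \<in> ?S" for y
      by (rule LIMSEQ_unique[OF conjunct1[OF g0[OF that]] glim[OF that]])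
    ultimately show ?thesis
      by (rule has_derivative_transform_within_open[OF _ open_ball x])
  qed
  have Glin: "G x (c *s v) = c * G x v" if "x \<in> ?S" for x c v
    using LIMSEQ_unique[OF Glim[OF that, of "c *s v"], of "c * G x v"]
      tendsto_mult_left[OF Glim[OF that, of v], of c] Dlin[OF that] by simp
  show hg: "holo_on ?S g"
    unfolding holo_on_def
  proof (intro conjI ballI)
    fix z assume "z \<in> ?S"
    from Gder[OF this] Glin[OF this]
    show "\<exists>f'. (g has_derivative f') (at z) \<and> (\<forall>c v. f' (c *s v) = c * f' v)" by metis
  qed simp
  show "uniform_limit ?S (\<lambda>n. cpartial j (f n)) (cpartial j g) sequentially"
    unfolding uniform_limit_iff
  proof (intro allI impI)
    fix e :: real assume "e > 0"
    then have "e/2 > 0" by simp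
    from unif[OF this] show "\<forall>\<^sub>F n in sequentially. \<forall>x\<in>?S. dist (cpartial j (f n) x) (cpartial j g x) < e"
    proof eventually_elim
      case (elim n)
      show ?case
      proof
        fix x assume x: "x \<in> ?S"
        have "cpartial j g x = G x (axis j 1)"
          using cpartial_eq_frechet[OF hg x] frechet_derivative_at[OF Gder[OF x]] by metis
        moreover have "cpartial j (f n) x = ?D n x (axis j 1)"
          using cpartial_eq_frechet[OF holo] x S by blast
        moreover have "norm (?D n x (axis j 1) - G x (axis j 1)) \<le> e/2 * norm (axis j (1::complex))"
          using elim x by blast
        ultimately show "dist (cpartial j (f n) x) (cpartial j g x) < e"
          using \<open>e > 0\<close> by (simp add: dist_norm)
      qed
    qed
  qed
qed

lemma loc_unif_holo:
  assumes "open U" "\<And>n. holo_on U (f n)" "loc_unif U f g"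
  shows "holo_on U g" and "loc_unif U (\<lambda>n. cpartial j (f n)) (cpartial j g)"
proof -
  have *: "\<exists>r>0. ball z r \<subseteq> U \<and> holo_on (ball z r) g \<and>
      uniform_limit (ball z r) (\<lambda>n. cpartial j (f n)) (cpartial j g) sequentially" if z: "z \<in> U" for z
  proof -
    obtain r where r: "r > 0" "ball z r \<subseteq> U" "uniform_limit (ball z r) f g sequentially"
      using assms(3) z unfolding loc_unif_def by blast
    have "ball z (r/2) \<subseteq> U" using r by (auto simp: subset_iff)
    moreover have "holo_on (ball z (r/2)) g \<and>
      uniform_limit (ball z (r/2)) (\<lambda>n. cpartial j (f n)) (cpartial j g) sequentially"
      using loc_unif_holo_local[where a = z and r = "r/2" and f = f and g = g] r
        holo_on_subset[OF assms(2), of "ball z r"] by simp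
    ultimately show ?thesis using r(1) by (intro exI[of _ "r/2"]) auto
  qed
  show "holo_on U g"
    by (rule holo_on_local[OF assms(1)]) (use * centre_in_ball in blast)
  show "loc_unif U (\<lambda>n. cpartial j (f n)) (cpartial j g)"
    unfolding loc_unif_def using * by blast
qed

lemma holo_on_bounded_cball:
  assumes "holo_on U f" "cball z r \<subseteq> U"
  obtains M where "M > 0" "\<And>x. x \<in> cball z r \<Longrightarrow> norm (f x) \<le> M"
proof -
  have "compact (f ` cball z r)"
    by (intro compact_continuous_image continuous_on_subset[OF holo_on_imp_continuous_on[OF assms(1)]] assms(2) compact_cball)
  then obtain M where "M > 0" "\<forall>y\<in>f ` cball z r. norm y \<le> M"
    using compact_imp_bounded bounded_pos by metis
  then show ?thesis using that by blast
qed

section \<open>Algebra of holomorphic functions and their partial derivatives\<close>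

lemma holo_on_lincomb:
  assumes "holo_on U f" "holo_on U g"
  shows "holo_on U (\<lambda>z. a * f z + b * g z)"
    and "z \<in> U \<Longrightarrow> cpartial j (\<lambda>z. a * f z + b * g z) z = a * cpartial j f z + b * cpartial j g z"
proof -
  let ?D = "\<lambda>z h. a * frechet_derivative f (at z) h + b * frechet_derivative g (at z) h"
  have d: "((\<lambda>z. a * f z + b * g z) has_derivative ?D z) (at z)" if "z \<in> U" for z
    by (intro derivative_intros holo_on_has_derivative(1)[OF _ that] assms)
  show h: "holo_on U (\<lambda>z. a * f z + b * g z)"
    unfolding holo_on_def
  proof (intro conjI ballI)
    fix z assume z: "z \<in> U"
    show "\<exists>f'. ((\<lambda>z. a * f z + b * g z) has_derivative f') (at z) \<and> (\<forall>c v. f' (c *s v) = c * f' v)"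
      by (intro exI[of _ "?D z"] conjI d[OF z])
         (simp add: holo_on_has_derivative(2)[OF _ z] assms algebra_simps)
  qed (use assms holo_on_open in blast)
  show "cpartial j (\<lambda>z. a * f z + b * g z) z = a * cpartial j f z + b * cpartial j g z" if z: "z \<in> U"
    by (simp add: cpartial_eq_frechet[OF h z] cpartial_eq_frechet[OF assms(1) z]
        cpartial_eq_frechet[OF assms(2) z] frechet_derivative_at[OF d[OF z], symmetric])
qed

lemma holo_on_mult:
  assumes "holo_on U f" "holo_on U g"
  shows "holo_on U (\<lambda>z. f z * g z)"
    and "z \<in> U \<Longrightarrow> cpartial j (\<lambda>z. f z * g z) z = f z * cpartial j g z + cpartial j f z * g z"
proof -
  let ?D = "\<lambda>z h. f z * frechet_derivative g (at z) h + frechet_derivative f (at z) h * g z"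
  have d: "((\<lambda>z. f z * g z) has_derivative ?D z) (at z)" if "z \<in> U" for z
    by (rule has_derivative_mult[OF holo_on_has_derivative(1)[OF assms(1) that] holo_on_has_derivative(1)[OF assms(2) that]])
  show h: "holo_on U (\<lambda>z. f z * g z)"
    unfolding holo_on_def
  proof (intro conjI ballI)
    fix z assume z: "z \<in> U"
    show "\<exists>f'. ((\<lambda>z. f z * g z) has_derivative f') (at z) \<and> (\<forall>c v. f' (c *s v) = c * f' v)"
      by (intro exI[of _ "?D z"] conjI d[OF z])
         (simp add: holo_on_has_derivative(2)[OF _ z] assms algebra_simps)
  qed (use assms holo_on_open in blast)
  show "cpartial j (\<lambda>z. f z * g z) z = f z * cpartial j g z + cpartial j f z * g z" if z: "z \<in> U"
    by (simp add: cpartial_eq_frechet[OF h z] cpartial_eq_frechet[OF assms(1) z]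
        cpartial_eq_frechet[OF assms(2) z] frechet_derivative_at[OF d[OF z], symmetric])
qed

lemma holo_on_const: "open U \<Longrightarrow> holo_on U (\<lambda>z. c)"
  unfolding holo_on_def by (auto intro!: exI[of _ "\<lambda>v. 0"])

lemma holo_on_sum:
  assumes "open U" "\<And>i. i \<in> I \<Longrightarrow> holo_on U (f i)"
  shows "holo_on U (\<lambda>z. \<Sum>i\<in>I. f i z)"
  using assms(2)
proof (induction I rule: infinite_finite_induct)
  case (insert i I)
  then show ?case
    using holo_on_lincomb(1)[of U "f i" "\<lambda>z. \<Sum>i\<in>I. f i z" 1 1] by simp
qed (simp_all add: holo_on_const[OF assms(1)])

lemma holo_on_prod:
  assumes "open U" "\<And>i. i \<in> I \<Longrightarrow> holo_on U (f i)"
  shows "holo_on U (\<lambda>z. \<Prod>i\<in>I. f i z)"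
  using assms(2)
proof (induction I rule: infinite_finite_induct)
  case (insert i I)
  then show ?case
    using holo_on_mult(1)[of U "f i" "\<lambda>z. \<Prod>i\<in>I. f i z"] by simp
qed (simp_all add: holo_on_const[OF assms(1)])

lemma holo_on_translate:
  assumes "holo_on U f" "open V" "\<And>z. z \<in> V \<Longrightarrow> z + a \<in> U"
  shows "holo_on V (\<lambda>z. f (z + a))"
    and "z \<in> V \<Longrightarrow> cpartial j (\<lambda>z. f (z + a)) z = cpartial j f (z + a)"
proof -
  have d: "((\<lambda>z. f (z + a)) has_derivative frechet_derivative f (at (z + a))) (at z)" if "z \<in> V" for z
    using has_derivative_compose[OF has_derivative_add_const[OF has_derivative_ident]
        holo_on_has_derivative(1)[OF assms(1) assms(3)[OF that]]] by simp
  show h: "holo_on V (\<lambda>z. f (z + a))"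
    unfolding holo_on_def
    using d assms holo_on_has_derivative(2)[OF assms(1) assms(3)] by blast
  show "cpartial j (\<lambda>z. f (z + a)) z = cpartial j f (z + a)" if z: "z \<in> V"
    by (simp add: cpartial_eq_frechet[OF h z] cpartial_eq_frechet[OF assms(1) assms(3)[OF z]]
        frechet_derivative_at[OF d[OF z], symmetric])
qed

section \<open>Holomorphy and symmetry of partial derivatives by difference quotients\<close>

lemma difference_quotient_error:
  assumes f: "holo_on U f" and sub: "cball x (2 * r) \<subseteq> U" and r: "r > 0"
    and M: "\<And>y. y \<in> cball x (2 * r) \<Longrightarrow> norm (f y) \<le> M"
    and h: "norm h < r"
  shows "norm (f (x + h *s axis j 1) - f x - h * cpartial j f x) \<le> 2 * M / r\<^sup>2 * (norm h)\<^sup>2"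
proof -
  define g where "g t = f (x + t *s axis j 1)" for t
  have in_cball: "x + t *s axis j 1 \<in> cball x (2 * r)" if "t \<in> cball 0 (2 * r)" for t
    using that by (simp add: norm_vector_smult dist_norm)
  have hol: "g holomorphic_on cball 0 (2 * r)"
    unfolding g_def by (rule holomorphic_on_line[OF f]) (use in_cball sub in blast)
  have sb: "cball t r \<subseteq> cball 0 (2 * r)" if "t \<in> ball 0 r" for t :: complex
    using that cball_subset_cball_iff[of t r 0 "2*r"] by (auto simp: dist_norm)
  \<comment> \<open>Taylor's formula of order one. The remainder needs the second derivative on the
    disc of radius \<open>r\<close>; discs of radius \<open>r\<close> about its points stay inside
    radius \<open>2 * r\<close>, where \<open>M\<close> bounds \<open>g\<close>, so Cauchy's
    inequality gives \<open>2 * M / r^2\<close>.\<close>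
  have "norm ((deriv ^^ 0) g h - (\<Sum>i\<le>1. (deriv ^^ i) g 0 * (h - 0) ^ i / fact i))
      \<le> 2 * M / r\<^sup>2 * norm (h - 0) ^ Suc 1 / fact 1"
  proof (rule field_Taylor[where S = "ball 0 r" and f = "\<lambda>i. (deriv ^^ i) g"])
    fix i and t :: complex assume t: "t \<in> ball 0 r"
    have "(deriv ^^ i) g holomorphic_on ball 0 (2 * r)"
      by (rule holomorphic_higher_deriv) (use hol in \<open>auto intro: holomorphic_on_subset\<close>)
    then show "((deriv ^^ i) g has_field_derivative (deriv ^^ Suc i) g t) (at t within ball 0 r)"
      using holomorphic_derivI[of "(deriv ^^ i) g" "ball 0 (2 * r)" t "ball 0 r"] t r by simp
  next
    fix t :: complex assume t: "t \<in> ball 0 r"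
    have "norm ((deriv ^^ 2) g t) \<le> fact 2 * M / r ^ 2"
    proof (rule Cauchy_inequality)
      show "g holomorphic_on ball t r"
        using hol sb[OF t] by (meson ball_subset_cball holomorphic_on_subset)
      show "continuous_on (cball t r) g"
        using hol sb[OF t] by (meson holomorphic_on_imp_continuous_on holomorphic_on_subset)
      show "norm (g y) \<le> M" if "norm (t - y) = r" for y
      proof -
        have "y \<in> cball t r" using that by (simp add: dist_norm)
        then show ?thesis unfolding g_def using M in_cball sb[OF t] by blast
      qed
    qed (use r in auto)
    then show "norm ((deriv ^^ Suc 1) g t) \<le> 2 * M / r\<^sup>2" by (simp add: numeral_2_eq_2)
  qed (use r h in auto)
  moreover have "deriv g 0 = cpartial j f x"
    using holo_on_line[OF f, of x 0 "axis j 1"] sub r cpartial_eq_frechet[OF f, of x j] unfolding g_def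
    by (simp add: DERIV_imp_deriv subset_iff)
  ultimately show ?thesis by (simp add: g_def power2_eq_square algebra_simps)
qed

text \<open>Exhibits the partial derivative as a uniform limit of functions made from
  \<open>f\<close> by translation and subtraction. Those are holomorphic, so Weierstrass's theorem
  carries holomorphy over to \<open>cpartial j f\<close> and convergence over to the next
  derivative.\<close>

lemma difference_quotients:
  fixes f :: "complex ^ 'n::finite \<Rightarrow> complex"
  assumes "holo_on U f" "z \<in> U"
  obtains r h where "r > 0" "ball z r \<subseteq> U" "\<And>n. h n \<noteq> 0" "h \<longlonglongrightarrow> 0"
    "\<And>n x. x \<in> ball z r \<Longrightarrow> x + h n *s axis j 1 \<in> U"
    "uniform_limit (ball z r) (\<lambda>n x. (f (x + h n *s axis j 1) - f x) / h n) (cpartial j f) sequentially"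
proof -
  obtain e where e: "e > 0" "cball z e \<subseteq> U"
    using holo_on_open[OF assms(1)] assms(2) open_contains_cball by blast
  obtain M where M: "M > 0" "\<And>x. x \<in> cball z e \<Longrightarrow> norm (f x) \<le> M"
    using holo_on_bounded_cball[OF assms(1) e(2)] by blast
  \<comment> \<open>A third, because the error estimate at a point of \<open>ball z r\<close> uses a
    ball of radius \<open>2 * r\<close> about that point.\<close>
  define r where "r = e / 3"
  have r: "r > 0" using e by (simp add: r_def)
  have sub: "cball x (2 * r) \<subseteq> cball z e" if "x \<in> ball z r" for x
    using that by (auto simp: cball_subset_cball_iff r_def dist_commute)
  \<comment> \<open>With \<open>n + 2\<close> even the first increment has norm
    \<open>r / 2\<close>, strictly between 0 and \<open>r\<close> as the error estimate
    demands.\<close>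
  define h :: "nat \<Rightarrow> complex" where "h n = of_real (r / real (n + 2))" for n
  have hn: "h n \<noteq> 0" "norm (h n) < r" for n
    using r by (auto simp: h_def norm_divide divide_less_eq simp del: of_real_divide of_real_add)
  have hlim: "h \<longlonglongrightarrow> 0"
  proof -
    have "(\<lambda>n. r / real (n + 2)) \<longlonglongrightarrow> 0"
      using LIMSEQ_ignore_initial_segment[OF lim_const_over_n, of r 2] by simp
    then show ?thesis unfolding h_def using tendsto_of_real[of _ 0, where 'a = complex] by fastforce
  qed
  have in_U: "x + h n *s axis j 1 \<in> U" if "x \<in> ball z r" for n x
  proof -
    have "x + h n *s axis j 1 \<in> cball x (2 * r)"
      using hn(2)[of n] r by (simp add: norm_vector_smult dist_norm)
    then show ?thesis using sub[OF that] e by blast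
  qed
  have "uniform_limit (ball z r) (\<lambda>n x. (f (x + h n *s axis j 1) - f x) / h n) (cpartial j f) sequentially"
    unfolding uniform_limit_iff
  proof (intro allI impI)
    fix d :: real assume "d > 0"
    have "(\<lambda>n. 2 * M / r\<^sup>2 * norm (h n)) \<longlonglongrightarrow> 2 * M / r\<^sup>2 * norm (0::complex)"
      by (intro tendsto_intros hlim)
    then have "\<forall>\<^sub>F n in sequentially. 2 * M / r\<^sup>2 * norm (h n) < d"
      using \<open>d > 0\<close> order_tendstoD(2) by fastforce
    then show "\<forall>\<^sub>F n in sequentially. \<forall>x\<in>ball z r.
        dist ((f (x + h n *s axis j 1) - f x) / h n) (cpartial j f x) < d"
    proof eventually_elim
      case (elim n)
      show ?case
      proof
        fix x assume x: "x \<in> ball z r"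
        have "norm (f (x + h n *s axis j 1) - f x - h n * cpartial j f x) \<le> 2 * M / r\<^sup>2 * (norm (h n))\<^sup>2"
          by (rule difference_quotient_error[OF assms(1)]) (use sub[OF x] e M r hn in auto)
        moreover have "(f (x + h n *s axis j 1) - f x) / h n - cpartial j f x
            = (f (x + h n *s axis j 1) - f x - h n * cpartial j f x) / h n"
          using hn(1) by (simp add: field_simps)
        ultimately have "norm ((f (x + h n *s axis j 1) - f x) / h n - cpartial j f x)
            \<le> 2 * M / r\<^sup>2 * (norm (h n))\<^sup>2 / norm (h n)"
          by (simp only: norm_divide) (intro divide_right_mono norm_ge_zero)
        also have "\<dots> = 2 * M / r\<^sup>2 * norm (h n)"
          using hn(1)[of n] by (simp add: power2_eq_square)
        finally show "dist ((f (x + h n *s axis j 1) - f x) / h n) (cpartial j f x) < d"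
          using elim by (simp add: dist_norm)
      qed
    qed
  qed
  moreover have "ball z r \<subseteq> U" using e r by (auto simp: r_def subset_iff)
  ultimately show ?thesis using that r hn(1) hlim in_U by blast
qed

lemma holo_on_difference_quotient:
  assumes "holo_on U f" "open V" "V \<subseteq> U" "\<And>x. x \<in> V \<Longrightarrow> x + a \<in> U"
  shows "holo_on V (\<lambda>x. (f (x + a) - f x) / h)"
    and "x \<in> V \<Longrightarrow> cpartial i (\<lambda>x. (f (x + a) - f x) / h) x = (cpartial i f (x + a) - cpartial i f x) / h"
proof -
  have 1: "holo_on V (\<lambda>x. f (x + a))" and 2: "holo_on V f"
    using holo_on_translate(1)[OF assms(1,2,4)] holo_on_subset[OF assms(1,2,3)] by auto
  have eq: "(\<lambda>x. (f (x + a) - f x) / h) = (\<lambda>x. (1/h) * f (x + a) + (-1/h) * f x)"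
    by (simp add: fun_eq_iff diff_divide_distrib)
  show "holo_on V (\<lambda>x. (f (x + a) - f x) / h)"
    unfolding eq by (rule holo_on_lincomb(1)[OF 1 2])
  show "cpartial i (\<lambda>x. (f (x + a) - f x) / h) x = (cpartial i f (x + a) - cpartial i f x) / h" if "x \<in> V"
    unfolding eq holo_on_lincomb(2)[OF 1 2 that]
    using holo_on_translate(2)[OF assms(1,2,4) that] by (simp add: diff_divide_distrib)
qed

lemma holo_on_cpartial:
  assumes "holo_on U f"
  shows "holo_on U (cpartial j f)"
proof (rule holo_on_local[OF holo_on_open[OF assms]])
  fix z assume "z \<in> U"
  obtain r h where rh: "r > 0" "ball z r \<subseteq> U" "\<And>n. h n \<noteq> (0::complex)" "h \<longlonglongrightarrow> 0"
    "\<And>n x. x \<in> ball z r \<Longrightarrow> x + h n *s axis j 1 \<in> U"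
    "uniform_limit (ball z r) (\<lambda>n x. (f (x + h n *s axis j 1) - f x) / h n) (cpartial j f) sequentially"
    by (rule difference_quotients[OF assms \<open>z \<in> U\<close>, where j = j]) (rule that; assumption)
  have "holo_on (ball z r) (cpartial j f)"
    using loc_unif_holo(1)[OF open_ball _ loc_unif_uniform_limit[OF open_ball rh(6)]]
      holo_on_difference_quotient(1)[OF assms open_ball rh(2)] rh(5) by blast
  then show "\<exists>V. z \<in> V \<and> holo_on V (cpartial j f)"
    using rh(1) by (intro exI[of _ "ball z r"]) simp
qed

text \<open>The \<open>i\<close>-derivatives of the difference quotients in direction
  \<open>j\<close> converge in two ways: Weierstrass's theorem gives one order of differentiation,
  the definition of the derivative of \<open>cpartial i f\<close> in direction \<open>j\<close>
  gives the other.\<close>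

lemma cpartial_commute:
  assumes "holo_on U f" "z \<in> U"
  shows "cpartial i (cpartial j f) z = cpartial j (cpartial i f) z"
proof -
  obtain r h where rh: "r > 0" "ball z r \<subseteq> U" "\<And>n. h n \<noteq> (0::complex)" "h \<longlonglongrightarrow> 0"
    "\<And>n x. x \<in> ball z r \<Longrightarrow> x + h n *s axis j 1 \<in> U"
    "uniform_limit (ball z r) (\<lambda>n x. (f (x + h n *s axis j 1) - f x) / h n) (cpartial j f) sequentially"
    by (rule difference_quotients[OF assms, where j = j]) (rule that; assumption)
  have z: "z \<in> ball z r" using rh(1) by simp
  have "loc_unif (ball z r) (\<lambda>n. cpartial i (\<lambda>x. (f (x + h n *s axis j 1) - f x) / h n)) (cpartial i (cpartial j f))"
    by (rule loc_unif_holo(2)[OF open_ball _ loc_unif_uniform_limit[OF open_ball rh(6)]])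
       (rule holo_on_difference_quotient(1)[OF assms(1) open_ball rh(2,5)])
  from loc_unif_pointwise[OF this z]
  have lim: "(\<lambda>n. (cpartial i f (z + h n *s axis j 1) - cpartial i f z) / h n) \<longlonglongrightarrow> cpartial i (cpartial j f) z"
    using holo_on_difference_quotient(2)[OF assms(1) open_ball rh(2,5) z] by simp
  have "((\<lambda>s. cpartial i f (z + s *s axis j 1)) has_field_derivative
      frechet_derivative (cpartial i f) (at z) (axis j 1)) (at 0)"
    using holo_on_line[OF holo_on_cpartial[OF assms(1)], of z 0 "axis j 1" i] assms(2) by simp
  then have "((\<lambda>s. cpartial i f (z + s *s axis j 1)) has_field_derivative cpartial j (cpartial i f) z) (at 0)"
    using cpartial_eq_frechet[OF holo_on_cpartial[OF assms(1)] assms(2)] by simp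
  then have "(\<lambda>s. (cpartial i f (z + s *s axis j 1) - cpartial i f z) / s) \<midarrow>0\<rightarrow> cpartial j (cpartial i f) z"
    unfolding DERIV_def by simp
  moreover have "filterlim h (at 0) sequentially"
    using rh(3,4) by (simp add: filterlim_at)
  ultimately have "(\<lambda>n. (cpartial i f (z + h n *s axis j 1) - cpartial i f z) / h n) \<longlonglongrightarrow> cpartial j (cpartial i f) z"
    using filterlim_compose by blast
  with lim show ?thesis using LIMSEQ_unique by blast
qed

section \<open>Iterated partial derivatives\<close>

lemma index_list: "distinct (index_list :: 'n::finite list)" "set (index_list :: 'n::finite list) = UNIV"
proof -
  have "\<exists>xs :: 'n list. distinct xs \<and> set xs = UNIV"
    using finite_distinct_list[of "UNIV :: 'n set"] by auto
  from someI_ex[OF this] show "distinct (index_list :: 'n list)" "set (index_list :: 'n list) = UNIV"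
    unfolding index_list_def by blast+
qed

text \<open>The properties of interest relate several functions, such as a sequence and its limit or
  two functions and their combination, and have to be carried through each differentiation jointly;
  hence an induction over a whole indexed family.\<close>

lemma Dmulti_family_induct:
  assumes "P F" "\<And>j F. P F \<Longrightarrow> P (\<lambda>i. cpartial j (F i))"
  shows "P (\<lambda>i. Dmulti l (F i))"
proof -
  have iter: "P (\<lambda>i. (cpartial j ^^ k) (F i))" if "P F" for F j k
    using that by (induction k) (simp_all add: assms(2))
  have "P (\<lambda>i. foldr (\<lambda>j g. (cpartial j ^^ l j) g) xs (F i))" for xs
    by (induction xs) (simp_all add: assms(1) iter)
  then show ?thesis unfolding Dmulti_def .
qed

lemma holo_on_Dmulti: "holo_on U f \<Longrightarrow> holo_on U (Dmulti l f)"
  using Dmulti_family_induct[of "\<lambda>F. holo_on U (F ())" "\<lambda>_. f"] holo_on_cpartial by blast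

lemma loc_unif_Dmulti:
  assumes "open U" "\<And>n. holo_on U (f n)" "loc_unif U f g"
  shows "loc_unif U (\<lambda>n. Dmulti l (f n)) (Dmulti l g)"
proof -
  \<comment> \<open>\<open>None\<close> indexes the limit, \<open>Some n\<close> the terms.
    Holomorphy of the terms belongs to the invariant because Weierstrass's theorem consumes it at
    every differentiation.\<close>
  define P where "P F \<longleftrightarrow> (\<forall>n. holo_on U (F (Some n))) \<and> loc_unif U (\<lambda>n. F (Some n)) (F None)" for F
  have "P (\<lambda>i. Dmulti l (case i of None \<Rightarrow> g | Some n \<Rightarrow> f n))"
  proof (rule Dmulti_family_induct)
    show "P (\<lambda>i. case i of None \<Rightarrow> g | Some n \<Rightarrow> f n)"
      using assms by (simp add: P_def)
    show "P (\<lambda>i. cpartial j (F i))" if "P F" for j F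
      using that unfolding P_def by (intro conjI allI holo_on_cpartial loc_unif_holo(2)[OF assms(1)]) auto
  qed
  then show ?thesis by (simp add: P_def)
qed

lemma Dmulti_lincomb:
  assumes "holo_on U f" "holo_on U g" "z \<in> U"
  shows "Dmulti l (\<lambda>z. a * f z + b * g z) z = a * Dmulti l f z + b * Dmulti l g z"
proof -
  \<comment> \<open>\<open>Some True\<close> stands for \<open>f\<close>, \<open>Some False\<close>
    for \<open>g\<close>, \<open>None\<close> for the combination. The identity is kept on
    \<open>U\<close> only, which suffices because partial derivatives respect equality on open
    sets.\<close>
  define P where "P F \<longleftrightarrow> holo_on U (F (Some True)) \<and> holo_on U (F (Some False)) \<and>
    (\<forall>z\<in>U. F None z = a * F (Some True) z + b * F (Some False) z)" for F
  have "P (\<lambda>i. Dmulti l (case i of None \<Rightarrow> (\<lambda>z. a * f z + b * g z) | Some c \<Rightarrow> if c then f else g))"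
  proof (rule Dmulti_family_induct)
    show "P (\<lambda>i. case i of None \<Rightarrow> (\<lambda>z. a * f z + b * g z) | Some c \<Rightarrow> if c then f else g)"
      using assms by (simp add: P_def)
    show "P (\<lambda>i. cpartial j (F i))" if "P F" for j F
      unfolding P_def
    proof (intro conjI ballI)
      show "holo_on U (cpartial j (F (Some True)))" "holo_on U (cpartial j (F (Some False)))"
        using that holo_on_cpartial unfolding P_def by auto
      fix z assume z: "z \<in> U"
      have "cpartial j (F None) z = cpartial j (\<lambda>z. a * F (Some True) z + b * F (Some False) z) z"
        by (rule cpartial_cong[OF holo_on_open[OF assms(1)] z]) (use that in \<open>simp add: P_def\<close>)
      also have "\<dots> = a * cpartial j (F (Some True)) z + b * cpartial j (F (Some False)) z"
        by (rule holo_on_lincomb(2)[OF _ _ z]) (use that in \<open>auto simp: P_def\<close>)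
      finally show "cpartial j (F None) z = a * cpartial j (F (Some True)) z + b * cpartial j (F (Some False)) z" .
    qed
  qed
  then show ?thesis using assms(3) by (simp add: P_def)
qed

lemma Dmulti_zero:
  assumes "open U" "z \<in> U"
  shows "Dmulti l (\<lambda>z. 0) z = 0"
  using Dmulti_lincomb[OF holo_on_const[OF assms(1)] holo_on_const[OF assms(1)] assms(2), of l 0 0 0 0] by simp

lemma Dmulti_sum:
  assumes "open U" "\<And>i. i \<in> I \<Longrightarrow> holo_on U (f i)" "z \<in> U"
  shows "Dmulti l (\<lambda>z. \<Sum>i\<in>I. f i z) z = (\<Sum>i\<in>I. Dmulti l (f i) z)"
  using assms(2)
proof (induction I rule: infinite_finite_induct)
  case (insert i I)
  then show ?case
    using Dmulti_lincomb[of U "f i" "\<lambda>z. \<Sum>i\<in>I. f i z" z l 1 1] holo_on_sum[OF assms(1), of I f] assms(3)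
    by simp
qed (simp_all add: Dmulti_zero[OF assms(1,3)])

lemma cpartial_iter_cong:
  assumes "open U" "\<And>z. z \<in> U \<Longrightarrow> f z = g z" "z \<in> U"
  shows "(cpartial j ^^ k) f z = (cpartial j ^^ k) g z"
  using assms(3)
proof (induction k arbitrary: z)
  case (Suc k)
  from cpartial_cong[OF assms(1) Suc.prems Suc.IH] show ?case by simp
qed (simp add: assms(2))

lemma holo_on_cpartial_iter: "holo_on U f \<Longrightarrow> holo_on U ((cpartial j ^^ k) f)"
  by (induction k) (simp_all add: holo_on_cpartial)

lemma cpartial_iter_commute:
  assumes "holo_on U f" "z \<in> U"
  shows "(cpartial i ^^ k) (cpartial j f) z = cpartial j ((cpartial i ^^ k) f) z"
  using assms(2)
proof (induction k arbitrary: z)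
  case (Suc k)
  have "(cpartial i ^^ Suc k) (cpartial j f) z = cpartial i (cpartial j ((cpartial i ^^ k) f)) z"
    using cpartial_cong[OF holo_on_open[OF assms(1)] Suc.prems Suc.IH] by simp
  also have "\<dots> = cpartial j ((cpartial i ^^ Suc k) f) z"
    using cpartial_commute[OF holo_on_cpartial_iter[OF assms(1)] Suc.prems] by simp
  finally show ?case .
qed simp

text \<open>\<open>Dmulti\<close> differentiates in the fixed order of \<open>index_list\<close>, so
  the extra derivative arises at the position of \<open>j\<close> and has to be commuted outwards
  past the directions listed before it.\<close>

lemma Dmulti_Suc:
  assumes f: "holo_on U f" and "z \<in> U"
  shows "Dmulti (l(j := Suc (l j))) f z = cpartial j (Dmulti l f) z"
proof -
  let ?D = "\<lambda>l xs. foldr (\<lambda>j g. (cpartial j ^^ l j) g) xs f"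
  let ?l = "l(j := Suc (l j))"
  note U = holo_on_open[OF f]
  have holo: "holo_on U (?D l xs)" for xs
    by (induction xs) (simp_all add: f holo_on_cpartial_iter)
  \<comment> \<open>For tails of the list that do not contain \<open>j\<close> the extra derivative
    has not yet occurred, hence the case distinction.\<close>
  have "?D ?l xs z = (if j \<in> set xs then cpartial j (?D l xs) z else ?D l xs z)"
    if "distinct xs" "z \<in> U" for xs
    using that
  proof (induction xs arbitrary: z)
    case (Cons a xs)
    show ?case
    proof (cases "a = j")
      case True
      then have eq: "?D ?l xs y = ?D l xs y" if "y \<in> U" for y using Cons that by simp
      show ?thesis
        using True cpartial_cong[OF U Cons.prems(2) cpartial_iter_cong[OF U eq]] by simp
    next
      case False
      show ?thesis
      proof (cases "j \<in> set xs")
        case True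
        then have "?D ?l xs y = cpartial j (?D l xs) y" if "y \<in> U" for y using Cons that by simp
        from cpartial_iter_cong[OF U this Cons.prems(2)] show ?thesis
          using True False cpartial_iter_commute[OF holo Cons.prems(2)] by simp
      next
        case j: False
        then have "?D ?l xs y = ?D l xs y" if "y \<in> U" for y using Cons that by simp
        from cpartial_iter_cong[OF U this Cons.prems(2)] show ?thesis
          using j False by simp
      qed
    qed
  qed simp
  from this[OF index_list(1) assms(2)] show ?thesis
    by (simp add: Dmulti_def index_list(2))
qed

section \<open>Multi-indices, monomials and Taylor polynomials\<close>

lemma mabs_eq_0_iff: "mabs l = 0 \<longleftrightarrow> l = (\<lambda>_. 0)"
  by (auto simp: mabs_def fun_eq_iff)

lemma Dmulti_0: "Dmulti (\<lambda>_. 0) f = f"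
proof -
  have "foldr (\<lambda>j g. (cpartial j ^^ 0) g) xs f = f" for xs by (induction xs) simp_all
  then show ?thesis by (simp add: Dmulti_def)
qed

lemma mabs_Suc: "mabs (l(j := Suc (l j))) = Suc (mabs l)"
  by (simp add: mabs_def sum.remove[of UNIV j])

text \<open>A sum over an infinite set defaults to 0; finiteness is what lets the sums in
  \<open>taylor_part\<close> and \<open>dnorm2\<close> be handled term by term.\<close>

lemma finite_mabs_less: "finite {p :: 'n::finite \<Rightarrow> nat. mabs p < m}"
proof (rule finite_subset)
  show "{p :: 'n \<Rightarrow> nat. mabs p < m} \<subseteq> PiE UNIV (\<lambda>_. {..<m})"
  proof
    fix p :: "'n \<Rightarrow> nat" assume "p \<in> {p. mabs p < m}"
    moreover have "p j \<le> mabs p" for j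
      unfolding mabs_def by (simp add: member_le_sum)
    ultimately show "p \<in> PiE UNIV (\<lambda>_. {..<m})" by (auto intro: le_less_trans)
  qed
qed (simp add: finite_PiE)

lemma finite_mabs_eq: "finite {p :: 'n::finite \<Rightarrow> nat. mabs p = m}"
  by (rule finite_subset[OF _ finite_mabs_less[of "Suc m"]]) auto

lemma mpow_remove: "mpow z p = (z $ j) ^ p j * (\<Prod>k\<in>UNIV - {j}. (z $ k) ^ p k)"
  unfolding mpow_def by (simp add: prod.remove[of UNIV j])

lemma cpartial_mpow:
  fixes p :: "'n::finite \<Rightarrow> nat"
  shows "cpartial j (\<lambda>z. c * mpow z p) = (\<lambda>z. c * of_nat (p j) * mpow z (p(j := p j - 1)))"
proof
  fix z :: "complex ^ 'n"
  let ?q = "\<Prod>k\<in>UNIV - {j}. (z $ k) ^ p k"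
  have "(\<lambda>t. c * mpow (\<chi> k. if k = j then t else z $ k) p) = (\<lambda>t. c * (t ^ p j * ?q))"
    by (simp add: mpow_remove[of _ p j])
  moreover have "((\<lambda>t. c * (t ^ p j * ?q)) has_field_derivative
      c * (of_nat (p j) * (z $ j) ^ (p j - 1) * ?q)) (at (z $ j))"
    by (auto intro!: derivative_eq_intros)
  ultimately show "cpartial j (\<lambda>z. c * mpow z p) z = c * of_nat (p j) * mpow z (p(j := p j - 1))"
    unfolding cpartial_def by (simp add: DERIV_imp_deriv mpow_remove[of _ _ j])
qed

text \<open>The product is a falling factorial in truncated subtraction: it acquires a factor 0 once
  \<open>k\<close> exceeds \<open>p j\<close>, so the truncated exponent does no harm.\<close>

lemma cpartial_iter_mpow:
  "(cpartial j ^^ k) (\<lambda>z. c * mpow z p)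
    = (\<lambda>z. c * of_nat (\<Prod>i<k. p j - i) * mpow z (p(j := p j - k)))"
proof (induction k)
  case (Suc k)
  have "(cpartial j ^^ Suc k) (\<lambda>z. c * mpow z p)
      = cpartial j (\<lambda>z. c * of_nat (\<Prod>i<k. p j - i) * mpow z (p(j := p j - k)))"
    by (simp only: funpow.simps o_apply Suc.IH)
  also have "\<dots> = (\<lambda>z. c * of_nat (\<Prod>i<Suc k. p j - i) * mpow z (p(j := p j - Suc k)))"
    unfolding cpartial_mpow by (simp only: prod.lessThan_Suc fun_upd_upd fun_upd_same of_nat_mult mult.assoc
        diff_diff_left add.commute plus_1_eq_Suc)
  finally show ?case .
qed simp

lemma Dmulti_mpow:
  "Dmulti l (\<lambda>z. c * mpow z p)
    = (\<lambda>z. c * of_nat (\<Prod>j\<in>UNIV. \<Prod>i<l j. p j - i) * mpow z (\<lambda>j. p j - l j))"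
proof -
  have "foldr (\<lambda>j g. (cpartial j ^^ l j) g) xs (\<lambda>z. c * mpow z p)
      = (\<lambda>z. c * of_nat (\<Prod>j\<in>set xs. \<Prod>i<l j. p j - i) * mpow z (\<lambda>j. if j \<in> set xs then p j - l j else p j))"
    if "distinct xs" for xs
    using that
  proof (induction xs)
    case (Cons a xs)
    let ?p = "\<lambda>j. if j \<in> set xs then p j - l j else p j"
    have "?p(a := ?p a - l a) = (\<lambda>j. if j \<in> set (a # xs) then p j - l j else p j)"
      using Cons.prems by auto
    moreover have "foldr (\<lambda>j g. (cpartial j ^^ l j) g) (a # xs) (\<lambda>z. c * mpow z p)
        = (cpartial a ^^ l a) (\<lambda>z. c * of_nat (\<Prod>j\<in>set xs. \<Prod>i<l j. p j - i) * mpow z ?p)"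
      using Cons by (simp only: foldr.simps o_apply distinct.simps)
    ultimately show ?case
      unfolding cpartial_iter_mpow using Cons.prems by (simp add: mult_ac)
  qed simp
  from this[OF index_list(1)] show ?thesis by (simp add: Dmulti_def index_list(2))
qed

text \<open>Duality between monomials and derivatives at 0. A coordinate with
  \<open>p j < l j\<close> kills the falling factorial through the factor \<open>i = p j\<close>;
  otherwise \<open>l \<noteq> p\<close> leaves a positive exponent and the monomial vanishes at
  0.\<close>

lemma Dmulti_mpow_0:
  "Dmulti l (\<lambda>z. c * mpow z p) 0 = (if l = p then c * of_real (mfact p) else 0)"
proof (cases "l = p")
  case True
  have "(\<Prod>i<k. k - i) = fact k" for k :: nat
    by (induction k) (simp_all add: lessThan_Suc_eq_insert_0 prod.reindex del: prod.lessThan_Suc)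
  then have "(\<Prod>j\<in>UNIV. \<Prod>i<p j. p j - i) = (\<Prod>j\<in>UNIV. fact (p j))" by simp
  then have "of_nat (\<Prod>j\<in>UNIV. \<Prod>i<p j. p j - i) = complex_of_real (mfact p)"
    by (simp only: of_nat_prod of_nat_fact mfact_def of_real_prod of_real_fact)
  then show ?thesis using True
    unfolding Dmulti_mpow by (simp add: mpow_def del: of_nat_prod)
next
  case False
  show ?thesis
  proof (cases "\<exists>j. p j < l j")
    case True
    then obtain j where "p j < l j" by blast
    then have "(\<Prod>i<l j. p j - i) = 0" by (auto intro!: bexI[of _ "p j"])
    then have "(\<Prod>j\<in>UNIV. \<Prod>i<l j. p j - i) = 0" by (meson UNIV_I finite prod_zero)
    then show ?thesis using False by (simp add: Dmulti_mpow)
  next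
    case le: False
    obtain j where "l j \<noteq> p j" using False by blast
    with le have "l j < p j" by (metis linorder_neqE_nat)
    then have "mpow 0 (\<lambda>j. p j - l j) = (0 :: complex)"
      unfolding mpow_def by (auto intro!: exI[of _ j])
    then show ?thesis using False by (simp add: Dmulti_mpow)
  qed
qed

lemma holo_on_mpow: "open U \<Longrightarrow> holo_on U (\<lambda>z. c * mpow z p)"
proof -
  assume U: "open U"
  have "holo_on U (\<lambda>z. z $ j)" for j
    unfolding holo_on_def
    using U bounded_linear.has_derivative[OF bounded_linear_vec_nth has_derivative_ident]
    by (auto intro!: exI[of _ "\<lambda>v. v $ j"])
  then have "holo_on U (\<lambda>z. (z $ j) ^ k)" for j k
    using holo_on_prod[OF U, of "{..<k}" "\<lambda>_ z. z $ j"] by simp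
  then have "holo_on U (\<lambda>z. mpow z p)"
    unfolding mpow_def by (intro holo_on_prod U)
  from holo_on_mult(1)[OF holo_on_const[OF U] this] show ?thesis .
qed

lemma holo_on_taylor_part: "open U \<Longrightarrow> holo_on U (taylor_part m f)"
  unfolding taylor_part_def by (intro holo_on_sum holo_on_mpow)

text \<open>Lets the low-order derivatives of \<open>f\<close> at 0 be estimated through the Taylor
  polynomial, which is the part of \<open>f\<close> that enters the norm.\<close>

lemma Dmulti_taylor_part:
  assumes "mabs l < m"
  shows "Dmulti l (taylor_part m f) 0 = Dmulti l f 0"
proof -
  have "Dmulti l (taylor_part m f) 0
      = (\<Sum>p\<in>{p. mabs p < m}. Dmulti l (\<lambda>z. Dmulti p f 0 / of_real (mfact p) * mpow z p) 0)"
    unfolding taylor_part_def by (rule Dmulti_sum[OF open_UNIV holo_on_mpow[OF open_UNIV] UNIV_I])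
  also have "\<dots> = (\<Sum>p\<in>{p. mabs p < m}. if l = p then Dmulti l f 0 else 0)"
    by (rule sum.cong) (simp_all only: Dmulti_mpow_0, auto simp: mfact_def)
  finally show ?thesis using assms by (simp add: finite_mabs_less)
qed

lemma taylor_part_lincomb:
  assumes "holo_on U f" "holo_on U g" "0 \<in> U"
  shows "taylor_part m (\<lambda>z. a * f z + b * g z) z = a * taylor_part m f z + b * taylor_part m g z"
  unfolding taylor_part_def Dmulti_lincomb[OF assms]
  by (simp add: sum_distrib_left sum.distrib[symmetric] add_divide_distrib algebra_simps)

lemma taylor_part_tendsto:
  assumes "\<And>p. (\<lambda>n. Dmulti p (f n) 0) \<longlonglongrightarrow> Dmulti p g 0"
  shows "(\<lambda>n. taylor_part m (f n) z) \<longlonglongrightarrow> taylor_part m g z"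
  unfolding taylor_part_def by (intro tendsto_intros assms) (simp add: mfact_def)

section \<open>Bounds on a function from bounds on its derivatives, and conversely\<close>

lemma frechet_bound_cpartial:
  assumes "holo_on U f" "z \<in> U" "\<And>j. norm (cpartial j f z) \<le> A"
  shows "norm (frechet_derivative f (at z) v) \<le> real CARD('n) * A * norm (v :: complex ^ 'n::finite)"
proof -
  let ?D = "frechet_derivative f (at z)"
  have "linear ?D" using holo_on_has_derivative(1)[OF assms(1,2)] has_derivative_linear by blast
  from linear_sum[OF this, of "\<lambda>j. v $ j *s axis j 1" UNIV]
  have "?D v = (\<Sum>j\<in>UNIV. ?D (v $ j *s axis j 1))"
    by (simp add: basis_expansion)
  also have "\<dots> = (\<Sum>j\<in>UNIV. v $ j * cpartial j f z)"
    by (simp add: holo_on_has_derivative(2)[OF assms(1,2)] cpartial_eq_frechet[OF assms(1,2)])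
  finally have "norm (?D v) \<le> (\<Sum>j\<in>UNIV. norm (v $ j * cpartial j f z))"
    by (simp add: norm_sum)
  also have "\<dots> \<le> (\<Sum>j\<in>(UNIV :: 'n set). norm v * A)"
    unfolding norm_mult by (intro sum_mono mult_mono Finite_Cartesian_Product.norm_nth_le assms(3) norm_ge_zero)
  finally show ?thesis by (simp add: mult_ac)
qed

text \<open>Integration from the origin, one order at a time: bounds on derivatives of order
  \<open>m + 1\<close> and the values at 0 bound those of order \<open>m\<close>. The constant is
  chosen before \<open>f\<close> and \<open>A\<close>, so it serves a whole function space.\<close>

lemma holo_bound_by_derivatives:
  fixes s :: real
  assumes "s > 0"
  shows "\<exists>C. \<forall>(f :: complex ^ 'n::finite \<Rightarrow> complex) A. holo_on (ball 0 s) f \<longrightarrow>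
      (\<forall>l. mabs l < m \<longrightarrow> norm (Dmulti l f 0) \<le> A) \<longrightarrow>
      (\<forall>l. mabs l = m \<longrightarrow> (\<forall>z\<in>ball 0 s. norm (Dmulti l f z) \<le> A)) \<longrightarrow>
      (\<forall>z\<in>ball 0 s. norm (f z) \<le> C * A)"
proof (induction m)
  case 0
  then show ?case by (intro exI[of _ 1]) (simp add: mabs_eq_0_iff Dmulti_0)
next
  case (Suc m)
  then obtain C where C: "\<And>(f :: complex ^ 'n \<Rightarrow> complex) A z. holo_on (ball 0 s) f \<Longrightarrow>
      (\<And>l. mabs l < m \<Longrightarrow> norm (Dmulti l f 0) \<le> A) \<Longrightarrow>
      (\<And>l z. mabs l = m \<Longrightarrow> z \<in> ball 0 s \<Longrightarrow> norm (Dmulti l f z) \<le> A) \<Longrightarrow> z \<in> ball 0 s \<Longrightarrow> norm (f z) \<le> C * A"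
    by meson
  \<comment> \<open>On \<open>ball 0 s\<close> a function of size at most \<open>A\<close> at 0 and
    with partial derivatives at most \<open>A\<close> is bounded by \<open>A + n * A * s\<close>,
    where \<open>n = CARD('n)\<close> comes from expanding a vector in coordinates.\<close>
  define N where "N = 1 + real CARD('n) * s"
  have N: "N \<ge> 1" using assms by (simp add: N_def)
  show ?case
  proof (intro exI[of _ "C * N"] allI impI ballI)
    fix f :: "complex ^ 'n \<Rightarrow> complex" and A and z :: "complex ^ 'n"
    assume f: "holo_on (ball 0 s) f" and z: "z \<in> ball 0 s"
      and low: "\<forall>l. mabs l < Suc m \<longrightarrow> norm (Dmulti l f 0) \<le> A"
      and top: "\<forall>l. mabs l = Suc m \<longrightarrow> (\<forall>z\<in>ball 0 s. norm (Dmulti l f z) \<le> A)"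
    have A: "A \<ge> 0" using low[rule_format, of "\<lambda>_. 0"] norm_ge_zero order_trans
      by (metis mabs_eq_0_iff zero_less_Suc)
    have AN: "A \<le> N * A" using N A mult_right_mono[of 1 N A] by simp
    have "norm (f z) \<le> C * (N * A)"
    proof (rule C[OF f _ _ z])
      show "norm (Dmulti l f 0) \<le> N * A" if "mabs l < m" for l
        using low that AN by (meson less_SucI order_trans)
      fix l :: "'n \<Rightarrow> nat" and x :: "complex ^ 'n" assume l: "mabs l = m" and x: "x \<in> ball 0 s"
      let ?g = "Dmulti l f"
      have g: "holo_on (ball 0 s) ?g" by (rule holo_on_Dmulti[OF f])
      have "norm (?g x - ?g 0) \<le> real CARD('n) * A * norm (x - 0)"
      proof (rule differentiable_bound[OF convex_ball])
        fix y :: "complex ^ 'n" assume y: "y \<in> ball 0 s"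
        show "(?g has_derivative frechet_derivative ?g (at y)) (at y within ball 0 s)"
          by (rule has_derivative_at_withinI[OF holo_on_has_derivative(1)[OF g y]])
        have "norm (cpartial j ?g y) \<le> A" for j
          using top[rule_format, of "l(j := Suc (l j))" y] Dmulti_Suc[OF f y] l y by (simp add: mabs_Suc)
        then show "onorm (frechet_derivative ?g (at y)) \<le> real CARD('n) * A"
          by (intro onorm_le frechet_bound_cpartial[OF g y])
      qed (use x assms in auto)
      also have "\<dots> \<le> real CARD('n) * A * s"
        using x A by (intro mult_left_mono) auto
      finally have "norm (?g x - ?g 0) \<le> real CARD('n) * A * s" .
      moreover have "norm (?g 0) \<le> A" using low l by simp
      ultimately show "norm (?g x) \<le> N * A"
        using norm_triangle_sub[of "?g x" "?g 0"] by (simp add: N_def algebra_simps)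
    qed
    then show "norm (f z) \<le> C * N * A" by (simp add: mult.assoc)
  qed
qed

text \<open>Each Cauchy estimate costs half of the radius, but only the value at 0 is wanted, so any
  remaining positive radius is enough. To keep constants independent of \<open>g\<close>, the
  induction runs over the family of all admissible pairs \<open>(g, M)\<close>
  simultaneously.\<close>

lemma Dmulti_Cauchy_bound:
  fixes r :: real
  assumes "r > 0"
  shows "\<exists>C. \<forall>(g :: complex ^ 'n::finite \<Rightarrow> complex) M. holo_on (ball 0 r) g \<longrightarrow>
      (\<forall>z\<in>ball 0 r. norm (g z) \<le> M) \<longrightarrow> norm (Dmulti l g 0) \<le> C * M"
proof -
  define I where "I = {(g :: complex ^ 'n \<Rightarrow> complex, M :: real). holo_on (ball 0 r) g \<and> (\<forall>z\<in>ball 0 r. norm (g z) \<le> M)}"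
  define P where "P F \<longleftrightarrow> (\<exists>r>0. \<exists>C. \<forall>i\<in>I. holo_on (ball 0 r) (F i) \<and> (\<forall>z\<in>ball 0 r. norm (F i z) \<le> C * snd i))"
    for F :: "_ \<Rightarrow> complex ^ 'n \<Rightarrow> complex"
  have "P (\<lambda>i. Dmulti l (fst i))"
  proof (rule Dmulti_family_induct)
    show "P fst" unfolding P_def using assms
      by (intro exI[of _ r] conjI exI[of _ 1]) (auto simp: I_def)
    fix j and F :: "_ \<Rightarrow> complex ^ 'n \<Rightarrow> complex" assume "P F"
    then obtain \<rho> C where \<rho>: "\<rho> > 0" and F: "\<And>i. i \<in> I \<Longrightarrow> holo_on (ball 0 \<rho>) (F i)"
      "\<And>i z. i \<in> I \<Longrightarrow> z \<in> ball 0 \<rho> \<Longrightarrow> norm (F i z) \<le> C * snd i"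
      unfolding P_def by blast
    have "holo_on (ball 0 (\<rho>/2)) (cpartial j (F i)) \<and>
        (\<forall>z\<in>ball 0 (\<rho>/2). norm (cpartial j (F i) z) \<le> C / (\<rho>/2) * snd i)" if i: "i \<in> I" for i
    proof (intro conjI ballI)
      show "holo_on (ball 0 (\<rho>/2)) (cpartial j (F i))"
        by (rule holo_on_subset[OF holo_on_cpartial[OF F(1)[OF i]]]) (use \<rho> in auto)
      fix z :: "complex ^ 'n" assume z: "z \<in> ball 0 (\<rho>/2)"
      then have z': "z \<in> ball 0 \<rho>" using \<rho> by simp
      have sub: "cball z (\<rho>/2) \<subseteq> ball 0 \<rho>"
      proof
        fix y assume "y \<in> cball z (\<rho>/2)"
        then show "y \<in> ball 0 \<rho>" using z norm_triangle_sub[of y z] by (simp add: dist_norm norm_minus_commute)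
      qed
      have "norm (frechet_derivative (F i) (at z) (axis j 1)) \<le> C * snd i / (\<rho>/2) * norm (axis j (1::complex) :: complex ^ 'n)"
        by (rule frechet_Cauchy_bound[OF F(1)[OF i] sub]) (use \<rho> F(2)[OF i] sub in auto)
      then show "norm (cpartial j (F i) z) \<le> C / (\<rho>/2) * snd i"
        using cpartial_eq_frechet[OF F(1)[OF i] z'] by (simp add: mult_ac)
    qed
    then show "P (\<lambda>i. cpartial j (F i))"
      unfolding P_def using \<rho> by (intro exI[of _ "\<rho>/2"] conjI exI[of _ "C / (\<rho>/2)"]) auto
  qed
  then obtain \<rho> C where \<rho>: "\<rho> > 0" and C: "\<And>i z. i \<in> I \<Longrightarrow> z \<in> ball 0 \<rho> \<Longrightarrow> norm (Dmulti l (fst i) z) \<le> C * snd i"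
    unfolding P_def by blast
  show ?thesis
  proof (intro exI[of _ C] allI impI)
    fix g :: "complex ^ 'n \<Rightarrow> complex" and M
    assume "holo_on (ball 0 r) g" "\<forall>z\<in>ball 0 r. norm (g z) \<le> M"
    then have "(g, M) \<in> I" by (simp add: I_def)
    from C[OF this, of 0] \<rho> show "norm (Dmulti l g 0) \<le> C * M" by simp
  qed
qed

section \<open>The mean value inequality on balls\<close>

lemma nn_integral_lborel_affine:
  fixes f :: "'a::euclidean_space \<Rightarrow> ennreal"
  assumes "f \<in> borel_measurable borel" "\<bar>c\<bar> = 1"
  shows "(\<integral>\<^sup>+x. f (t + c *\<^sub>R x) \<partial>lborel) = (\<integral>\<^sup>+x. f x \<partial>lborel)"
proof -
  have "(\<integral>\<^sup>+x. f x \<partial>lborel) = (\<integral>\<^sup>+x. f x \<partial>density (distr lborel borel (\<lambda>x. t + c *\<^sub>R x)) (\<lambda>_. \<bar>c\<bar> ^ DIM('a)))"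
    using lborel_affine[of c t] assms(2) by auto
  also have "\<dots> = (\<integral>\<^sup>+x. f (t + c *\<^sub>R x) \<partial>lborel)"
    using assms by (simp add: nn_integral_density nn_integral_distr)
  finally show ?thesis by simp
qed

text \<open>Uniqueness of translation-invariant measures: computing
  the integral of \<open>indicator A (T x) * indicator B y\<close> over all \<open>x\<close>, \<open>y\<close> in two ways for the unit ball \<open>B\<close>,
  which \<open>T\<close> preserves.\<close>

lemma lborel_distr_linear_isometry:
  fixes T :: "'a::euclidean_space \<Rightarrow> 'a"
  assumes lin: "linear T" and iso: "\<And>x. norm (T x) = norm x"
  shows "distr lborel borel T = lborel"
proof (rule measure_eqI)
  fix A :: "'a set" assume "A \<in> sets (distr lborel borel T)"
  then have A[measurable]: "A \<in> sets borel" by simp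
  have [measurable]: "T \<in> borel_measurable borel"
    using lin by (intro borel_measurable_continuous_onI linear_continuous_on) (simp add: linear_linear)
  have "inj T"
    using iso by (simp add: linear_injective_0[OF lin]) (metis norm_eq_zero)
  then have "surj T" using lin by (simp add: linear_injective_imp_surjective)
  let ?B = "ball 0 1 :: 'a set"
  have [measurable]: "?B \<in> sets borel" by simp
  have TB: "T x \<in> ?B \<longleftrightarrow> x \<in> ?B" for x using iso[of x] by simp
  have swap: "(\<integral>\<^sup>+x. \<integral>\<^sup>+y. G x y \<partial>lborel \<partial>lborel) = (\<integral>\<^sup>+y. \<integral>\<^sup>+x. G x y \<partial>lborel \<partial>lborel)"
    if "case_prod G \<in> borel_measurable (borel \<Otimes>\<^sub>M borel)" for G :: "'a \<Rightarrow> 'a \<Rightarrow> ennreal"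
    using lborel_pair.Fubini'[of G] that by (simp add: measurable_cong_sets[OF sets_pair_measure_cong[OF sets_lborel sets_lborel] refl])
  have "emeasure (distr lborel borel T) A = (\<integral>\<^sup>+x. indicator A (T x) \<partial>lborel)"
    using nn_integral_distr[of T lborel borel "indicator A"] by simp
  then have "emeasure (distr lborel borel T) A * emeasure lborel ?B
      = (\<integral>\<^sup>+x. \<integral>\<^sup>+y. indicator A (T x) * indicator ?B y \<partial>lborel \<partial>lborel)"
    by (simp add: nn_integral_cmult_indicator nn_integral_multc)
  also have "\<dots> = (\<integral>\<^sup>+x. \<integral>\<^sup>+y. indicator A (T x) * indicator ?B (y - T x) \<partial>lborel \<partial>lborel)"
  proof (rule nn_integral_cong)
    fix x
    have "(\<lambda>y. indicator A (T x) * indicator ?B y :: ennreal) \<in> borel_measurable borel"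
      by (intro borel_measurable_times_ennreal borel_measurable_indicator) simp_all
    from nn_integral_lborel_affine[OF this, of 1 "- T x"]
    show "(\<integral>\<^sup>+y. indicator A (T x) * indicator ?B y \<partial>lborel) = (\<integral>\<^sup>+y. indicator A (T x) * indicator ?B (y - T x) \<partial>lborel)"
      by simp
  qed
  also have "\<dots> = (\<integral>\<^sup>+y. \<integral>\<^sup>+x. indicator A (T x) * indicator ?B (y - T x) \<partial>lborel \<partial>lborel)"
    by (rule swap) measurable
  \<comment> \<open>With \<open>y = T u\<close>, the measure-preserving substitution of
    \<open>u - x\<close> for \<open>x\<close> turns \<open>T x\<close> into \<open>y - T x\<close>
    and so interchanges the arguments of the two indicators.\<close>
  also have "\<dots> = (\<integral>\<^sup>+y. \<integral>\<^sup>+x. indicator A (y - T x) * indicator ?B (T x) \<partial>lborel \<partial>lborel)"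
  proof (rule nn_integral_cong)
    fix y
    obtain u where u: "y = T u" using \<open>surj T\<close> by (metis surjD)
    have "T (u + (-1) *\<^sub>R x) = y - T x" for x using lin u by (simp add: linear_diff)
    then show "(\<integral>\<^sup>+x. indicator A (T x) * indicator ?B (y - T x) \<partial>lborel) = (\<integral>\<^sup>+x. indicator A (y - T x) * indicator ?B (T x) \<partial>lborel)"
      using nn_integral_lborel_affine[of "\<lambda>x. indicator A (T x) * indicator ?B (y - T x)" "-1" u] by simp
  qed
  also have "\<dots> = (\<integral>\<^sup>+x. \<integral>\<^sup>+y. indicator A (y - T x) * indicator ?B (T x) \<partial>lborel \<partial>lborel)"
    by (rule swap[symmetric]) measurable
  also have "\<dots> = (\<integral>\<^sup>+x. emeasure lborel A * indicator ?B x \<partial>lborel)"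
  proof (rule nn_integral_cong)
    fix x
    have "(\<integral>\<^sup>+y. indicator A (y - T x) * indicator ?B (T x) \<partial>lborel) = (\<integral>\<^sup>+y. indicator A y * indicator ?B (T x) \<partial>lborel)"
      using nn_integral_lborel_affine[of "\<lambda>y. indicator A y * indicator ?B (T x)" 1 "- T x"] by simp
    also have "\<dots> = emeasure lborel A * indicator ?B (T x)" by (simp add: nn_integral_multc)
    finally show "(\<integral>\<^sup>+y. indicator A (y - T x) * indicator ?B (T x) \<partial>lborel) = emeasure lborel A * indicator ?B x"
      using TB[of x] by (simp add: indicator_def)
  qed
  also have "\<dots> = emeasure lborel A * emeasure lborel ?B" by (simp add: nn_integral_cmult)
  finally have eq: "emeasure (distr lborel borel T) A * emeasure lborel ?B = emeasure lborel A * emeasure lborel ?B" .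
  have "emeasure lborel ?B \<noteq> 0"
    using content_ball_pos[of 1 "0::'a"] by (auto simp: Sigma_Algebra.measure_def)
  moreover have "emeasure lborel ?B \<noteq> \<infinity>" using emeasure_lborel_ball_finite[of "0::'a" 1] by simp
  ultimately show "emeasure (distr lborel borel T) A = emeasure lborel A"
    using eq by (simp add: mult.commute[of _ "emeasure lborel ?B"] ennreal_mult_cancel_left)
qed simp

lemma nn_integral_lborel_rotation:
  fixes F :: "complex ^ 'n::finite \<Rightarrow> ennreal"
  assumes "F \<in> borel_measurable borel" "cmod c = 1"
  shows "(\<integral>\<^sup>+z. F (c *s z) \<partial>lborel) = (\<integral>\<^sup>+z. F z \<partial>lborel)"
proof -
  have lin: "linear (\<lambda>z :: complex ^ 'n. c *s z)"
    by (intro linearI) (simp_all add: vec_eq_iff algebra_simps)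
  have m: "(\<lambda>z :: complex ^ 'n. c *s z) \<in> borel_measurable borel"
    using lin by (intro borel_measurable_continuous_onI linear_continuous_on) (simp add: linear_linear)
  have "(\<integral>\<^sup>+z. F z \<partial>lborel) = (\<integral>\<^sup>+z. F z \<partial>distr lborel borel (\<lambda>z. c *s z))"
    using lborel_distr_linear_isometry[OF lin] assms(2) by (simp add: norm_vector_smult)
  also have "\<dots> = (\<integral>\<^sup>+z. F (c *s z) \<partial>lborel)"
    using assms m by (simp add: nn_integral_distr)
  finally show ?thesis by simp
qed

lemma borel_measurable_ennreal_on_open:
  fixes f :: "'a::topological_space \<Rightarrow> real"
  assumes "open U" "continuous_on U f"
  shows "(\<lambda>z. ennreal (f z) * indicator U z) \<in> borel_measurable borel"
proof -
  have "(\<lambda>z. ennreal (indicator U z *\<^sub>R f z)) \<in> borel_measurable borel"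
    using borel_measurable_continuous_on_indicator[OF _ assms(2)] assms(1) by simp
  moreover have "(\<lambda>z. ennreal (indicator U z *\<^sub>R f z)) = (\<lambda>z. ennreal (f z) * indicator U z)"
    by (auto simp: fun_eq_iff indicator_def)
  ultimately show ?thesis by simp
qed

text \<open>Cauchy's integral formula at the centre, in absolute value. Stating it with a
  nonnegative integral spares integrability conditions when it is put under Fubini's
  theorem.\<close>

lemma circle_mean_value:
  assumes "g holomorphic_on cball 0 1"
  shows "ennreal (2 * pi * cmod (g 0)) \<le> (\<integral>\<^sup>+t. ennreal (cmod (g (cis t))) * indicator {0..2*pi} t \<partial>lborel)"
proof -
  have "((\<lambda>u. g u / (u - 0)) has_contour_integral (2 * of_real pi * \<i> * g 0)) (part_circlepath 0 1 0 (2*pi))"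
    using Cauchy_integral_circlepath_simple[OF assms, of 0] by (simp add: circlepath_def)
  then have "((\<lambda>t. g (cis t) * \<i>) has_integral (2 * of_real pi * \<i> * g 0)) {0..2*pi}"
    by (subst (asm) has_contour_integral_part_circlepath_iff) (auto simp: mult_ac)
  \<comment> \<open>The factor \<open>-\<i>\<close> cancels the \<open>\<i>\<close> that the
    parametrisation \<open>cis t\<close> contributes to \<open>du / u\<close>.\<close>
  from has_integral_mult_left[OF this, of "-\<i>"]
  have int: "((\<lambda>t. g (cis t)) has_integral (2 * of_real pi * g 0)) {0..2*pi}"
    by (simp add: mult_ac)
  have cont: "continuous_on {0..2*pi} (\<lambda>t. g (cis t))"
    by (rule continuous_on_compose2[OF holomorphic_on_imp_continuous_on[OF assms]])
       (auto intro!: continuous_intros)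
  have si: "set_integrable lborel {0..2*pi} (\<lambda>t. g (cis t))"
    unfolding set_integrable_def using borel_integrable_compact[OF _ cont] by simp
  have "(LINT t:{0..2*pi}|lborel. g (cis t)) = 2 * of_real pi * g 0"
    using set_borel_integral_eq_integral(2)[OF si] int by (simp add: integral_unique)
  then have "ennreal (2 * pi * cmod (g 0)) = ennreal (norm (LINT t:{0..2*pi}|lborel. g (cis t)))"
    by (simp add: norm_mult)
  also have "\<dots> \<le> (\<integral>\<^sup>+t. ennreal (norm (indicator {0..2*pi} t *\<^sub>R g (cis t))) \<partial>lborel)"
    unfolding set_lebesgue_integral_def
    by (rule integral_norm_bound_ennreal) (use si in \<open>simp add: set_integrable_def\<close>)
  also have "\<dots> = (\<integral>\<^sup>+t. ennreal (cmod (g (cis t))) * indicator {0..2*pi} t \<partial>lborel)"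
    by (rule nn_integral_cong) (simp add: indicator_def)
  finally show ?thesis .
qed

text \<open>Replacing \<open>u\<close> by \<open>cis t *s u\<close> preserves the centred ball and
  Lebesgue measure, so averaging over \<open>t\<close> leaves the integral unchanged; by Fubini the
  inner average is a circle mean along the complex line through \<open>z\<close> and
  \<open>z + u\<close>. Both sides carry the factor \<open>2 * pi\<close>, cancelled at the
  end.\<close>

lemma holo_mean_value:
  fixes g :: "complex ^ 'n::finite \<Rightarrow> complex"
  assumes g: "holo_on U g" and sub: "ball z r \<subseteq> U" and r: "r > 0"
  shows "ennreal ((cmod (g z))\<^sup>2) * emeasure lborel (ball (0 :: complex ^ 'n) r)
    \<le> (\<integral>\<^sup>+u. ennreal ((cmod (g u))\<^sup>2) * indicator (ball z r) u \<partial>lborel)"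
proof -
  define F where "F u = ennreal ((cmod (g (z + u)))\<^sup>2) * indicator (ball 0 r) u" for u
  have cont: "continuous_on (ball z r) (\<lambda>u. (cmod (g u))\<^sup>2)"
    by (intro continuous_intros continuous_on_subset[OF holo_on_imp_continuous_on[OF g] sub])
  have meas0: "(\<lambda>u. ennreal ((cmod (g u))\<^sup>2) * indicator (ball z r) u) \<in> borel_measurable borel"
    by (rule borel_measurable_ennreal_on_open[OF open_ball cont])
  have F_eq: "F u = ennreal ((cmod (g (z + u)))\<^sup>2) * indicator (ball z r) (z + u)" for u
    by (simp add: F_def indicator_def dist_norm)
  have F[measurable]: "F \<in> borel_measurable borel"
    unfolding F_eq by (rule measurable_compose[OF _ meas0]) simp
  have smult: "(\<lambda>(t, u). F (cis t *s u)) \<in> borel_measurable (borel \<Otimes>\<^sub>M borel)"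
  proof -
    have "continuous_on UNIV (\<lambda>p :: real \<times> (complex ^ 'n). cis (fst p) *s snd p)"
      unfolding vector_scalar_mult_def by (intro continuous_intros)
    then have "(\<lambda>p. F (cis (fst p) *s snd p)) \<in> borel_measurable borel"
      by (intro measurable_compose[OF borel_measurable_continuous_onI F])
    then show ?thesis by (simp add: borel_prod case_prod_beta)
  qed
  let ?I = "{0..2*pi}"
  have "ennreal (2 * pi) * (ennreal ((cmod (g z))\<^sup>2) * emeasure lborel (ball (0 :: complex ^ 'n) r))
      = (\<integral>\<^sup>+u. ennreal (2 * pi * (cmod (g z))\<^sup>2) * indicator (ball (0 :: complex ^ 'n) r) u \<partial>lborel)"
    by (subst nn_integral_cmult_indicator) (simp_all add: ennreal_mult mult.assoc)
  also have "\<dots> \<le> (\<integral>\<^sup>+u. \<integral>\<^sup>+t. F (cis t *s u) * indicator ?I t \<partial>lborel \<partial>lborel)"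
  proof (rule nn_integral_mono)
    fix u :: "complex ^ 'n"
    show "ennreal (2 * pi * (cmod (g z))\<^sup>2) * indicator (ball 0 r) u \<le> (\<integral>\<^sup>+t. F (cis t *s u) * indicator ?I t \<partial>lborel)"
    proof (cases "u \<in> ball 0 r")
      case True
      \<comment> \<open>The square of \<open>g\<close> is again holomorphic, and its modulus is the
        squared modulus of \<open>g\<close>; the circle estimate for moduli thus already gives the
        one in square mean.\<close>
      define h where "h s = (g (z + s *s u))\<^sup>2" for s
      have "z + s *s u \<in> U" if "s \<in> cball 0 1" for s
      proof -
        have "norm (s *s u) \<le> 1 * norm u"
          unfolding norm_vector_smult using that by (intro mult_right_mono) auto
        then have "z + s *s u \<in> ball z r" using True by (simp add: dist_norm)
        then show ?thesis using sub by blast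
      qed
      then have "h holomorphic_on cball 0 1"
        unfolding h_def by (intro holomorphic_intros holomorphic_on_line[OF g])
      from circle_mean_value[OF this]
      have "ennreal (2 * pi * (cmod (g z))\<^sup>2) \<le> (\<integral>\<^sup>+t. ennreal (cmod (h (cis t))) * indicator ?I t \<partial>lborel)"
        by (simp add: h_def norm_power)
      also have "\<dots> = (\<integral>\<^sup>+t. F (cis t *s u) * indicator ?I t \<partial>lborel)"
        using True by (intro nn_integral_cong) (simp add: h_def F_def norm_power norm_vector_smult)
      finally show ?thesis using True by simp
    qed simp
  qed
  also have "\<dots> = (\<integral>\<^sup>+t. \<integral>\<^sup>+u. F (cis t *s u) * indicator ?I t \<partial>lborel \<partial>lborel)"
  proof (rule lborel_pair.Fubini')
    have "(\<lambda>p. (case p of (t, u) \<Rightarrow> F (cis t *s u)) * indicator ?I (fst p)) \<in> borel_measurable (borel \<Otimes>\<^sub>M borel)"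
      by (intro borel_measurable_times_ennreal smult) simp
    then show "(\<lambda>(t, u). F (cis t *s u) * indicator ?I t) \<in> borel_measurable (lborel \<Otimes>\<^sub>M lborel)"
      by (simp add: case_prod_beta)
  qed
  also have "\<dots> = (\<integral>\<^sup>+t. (\<integral>\<^sup>+u. F u \<partial>lborel) * indicator ?I t \<partial>lborel)"
  proof (rule nn_integral_cong)
    fix t
    have "(\<lambda>u. F (cis t *s u)) \<in> borel_measurable borel"
      using measurable_Pair1'[THEN measurable_compose, OF _ smult, of t] by simp
    then show "(\<integral>\<^sup>+u. F (cis t *s u) * indicator ?I t \<partial>lborel) = (\<integral>\<^sup>+u. F u \<partial>lborel) * indicator ?I t"
      using nn_integral_lborel_rotation[OF F, of "cis t"] by (simp add: nn_integral_multc)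
  qed
  also have "\<dots> = ennreal (2 * pi) * (\<integral>\<^sup>+u. F u \<partial>lborel)"
    by (simp add: nn_integral_cmult_indicator mult.commute)
  also have "(\<integral>\<^sup>+u. F u \<partial>lborel) = (\<integral>\<^sup>+u. ennreal ((cmod (g u))\<^sup>2) * indicator (ball z r) u \<partial>lborel)"
    using nn_integral_lborel_affine[OF meas0, of 1 z] by (simp add: F_eq)
  finally show ?thesis
    by (subst (asm) ennreal_mult_le_mult_iff) auto
qed

section \<open>Reproducing kernels of Dirichlet spaces\<close>

lemma mfact_pos: "0 < mfact l"
  by (simp add: mfact_def prod_pos)

text \<open>Covers the balls and the Gaussian case at once. Continuity and positivity give the
  weight a positive minimum on compact sets; the origin lies in the domain because the Taylor part
  is taken there.\<close>

locale dirichlet_space =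
  fixes U :: "(complex ^ 'n::finite) set" and \<omega> :: "complex ^ 'n \<Rightarrow> real" and m :: nat
  assumes open_U: "open U" and zero_in_U: "0 \<in> U"
    and continuous_weight: "continuous_on U \<omega>"
    and weight_pos: "\<And>z. z \<in> U \<Longrightarrow> 0 < \<omega> z"
begin

lemma measurable_wnorm2:
  assumes "continuous_on U g"
  shows "(\<lambda>z. ennreal ((cmod (g z))\<^sup>2 * \<omega> z) * indicator U z) \<in> borel_measurable lborel"
  using borel_measurable_ennreal_on_open[OF open_U, of "\<lambda>z. (cmod (g z))\<^sup>2 * \<omega> z"]
    assms continuous_weight by (simp add: continuous_intros)

lemma winner_integrable:
  assumes f: "continuous_on U f" "wnorm2 U \<omega> f < \<infinity>" and g: "continuous_on U g" "wnorm2 U \<omega> g < \<infinity>"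
  shows "set_integrable lborel U (\<lambda>z. f z * cnj (g z) * of_real (\<omega> z))"
  unfolding set_integrable_def
proof (rule integrableI_bounded)
  have "continuous_on U (\<lambda>z. f z * cnj (g z) * of_real (\<omega> z))"
    by (intro continuous_intros f g continuous_weight)
  from borel_measurable_continuous_on_indicator[OF _ this]
  show "(\<lambda>z. indicator U z *\<^sub>R (f z * cnj (g z) * of_real (\<omega> z))) \<in> borel_measurable lborel"
    using open_U by simp
  have "(\<integral>\<^sup>+z. ennreal (norm (indicator U z *\<^sub>R (f z * cnj (g z) * of_real (\<omega> z)))) \<partial>lborel)
      \<le> (\<integral>\<^sup>+z. ennreal ((cmod (f z))\<^sup>2 * \<omega> z) * indicator U z + ennreal ((cmod (g z))\<^sup>2 * \<omega> z) * indicator U z \<partial>lborel)"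
  proof (rule nn_integral_mono)
    fix z
    show "ennreal (norm (indicator U z *\<^sub>R (f z * cnj (g z) * of_real (\<omega> z))))
        \<le> ennreal ((cmod (f z))\<^sup>2 * \<omega> z) * indicator U z + ennreal ((cmod (g z))\<^sup>2 * \<omega> z) * indicator U z"
    proof (cases "z \<in> U")
      case True
      have "cmod (f z) * cmod (g z) \<le> (cmod (f z))\<^sup>2 + (cmod (g z))\<^sup>2"
        using sum_squares_bound[of "cmod (f z)" "cmod (g z)"]
          mult_nonneg_nonneg[OF norm_ge_zero[of "f z"] norm_ge_zero[of "g z"]]
        unfolding mult.assoc by linarith
      then have "cmod (f z) * cmod (g z) * \<omega> z \<le> ((cmod (f z))\<^sup>2 + (cmod (g z))\<^sup>2) * \<omega> z"
        using weight_pos[OF True] by (intro mult_right_mono) auto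
      then show ?thesis using True weight_pos[OF True]
        by (simp add: norm_mult ennreal_plus[symmetric] distrib_right ennreal_leI del: ennreal_plus)
    qed simp
  qed
  also have "\<dots> = wnorm2 U \<omega> f + wnorm2 U \<omega> g"
    unfolding wnorm2_def by (rule nn_integral_add) (intro measurable_wnorm2 f g)+
  also have "\<dots> < \<infinity>" using f g by simp
  finally show "(\<integral>\<^sup>+z. ennreal (norm (indicator U z *\<^sub>R (f z * cnj (g z) * of_real (\<omega> z)))) \<partial>lborel) < \<infinity>" .
qed

text \<open>\<open>wnorm2\<close> is an extended nonnegative integral, \<open>winner\<close> a
  Bochner integral, which would default to 0 without integrability; finiteness makes the two
  agree.\<close>

lemma winner_self:
  assumes "continuous_on U f" "wnorm2 U \<omega> f < \<infinity>"
  shows "Im (winner U \<omega> f f) = 0" "0 \<le> Re (winner U \<omega> f f)" "wnorm2 U \<omega> f = ennreal (Re (winner U \<omega> f f))"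
proof -
  let ?h = "\<lambda>z. indicator U z *\<^sub>R ((cmod (f z))\<^sup>2 * \<omega> z)"
  have eq: "indicator U z *\<^sub>R (f z * cnj (f z) * of_real (\<omega> z)) = complex_of_real (?h z)" for z
    unfolding complex_norm_square[symmetric] by (simp add: indicator_def)
  have "integrable lborel (\<lambda>z. complex_of_real (?h z))"
    using winner_integrable[OF assms assms] unfolding set_integrable_def eq .
  then have int: "integrable lborel ?h" by (rule complex_of_real_integrable_eq[THEN iffD1])
  have w: "winner U \<omega> f f = of_real (integral\<^sup>L lborel ?h)"
    unfolding winner_def set_lebesgue_integral_def eq by (simp only: integral_complex_of_real)
  have nonneg: "0 \<le> ?h z" for z
    using weight_pos[of z] by (cases "z \<in> U") auto
  have "wnorm2 U \<omega> f = (\<integral>\<^sup>+z. ennreal (?h z) \<partial>lborel)"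
    unfolding wnorm2_def by (rule nn_integral_cong) (auto simp: indicator_def)
  also have "\<dots> = ennreal (integral\<^sup>L lborel ?h)"
    by (rule nn_integral_eq_integral[OF int AE_I2[OF nonneg]])
  finally show "wnorm2 U \<omega> f = ennreal (Re (winner U \<omega> f f))" using w by simp
  show "Im (winner U \<omega> f f) = 0" "0 \<le> Re (winner U \<omega> f f)"
    using w integral_nonneg_AE[OF AE_I2[OF nonneg]] by simp_all
qed

lemma winner_cnj: "winner U \<omega> g f = cnj (winner U \<omega> f g)"
proof -
  have "cnj (winner U \<omega> f g) = (\<integral>z. cnj (indicator U z *\<^sub>R (f z * cnj (g z) * of_real (\<omega> z))) \<partial>lborel)"
    unfolding winner_def set_lebesgue_integral_def by (rule Bochner_Integration.integral_cnj[symmetric])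
  also have "\<dots> = winner U \<omega> g f"
    unfolding winner_def set_lebesgue_integral_def by (rule Bochner_Integration.integral_cong) (simp_all add: mult_ac)
  finally show ?thesis by simp
qed

lemma winner_cong:
  assumes "\<And>z. z \<in> U \<Longrightarrow> f z = f' z" "\<And>z. z \<in> U \<Longrightarrow> g z = g' z"
  shows "winner U \<omega> f g = winner U \<omega> f' g'"
  unfolding winner_def set_lebesgue_integral_def
  by (rule Bochner_Integration.integral_cong) (auto simp: indicator_def assms)

lemma wnorm2_cong:
  assumes "\<And>z. z \<in> U \<Longrightarrow> f z = f' z"
  shows "wnorm2 U \<omega> f = wnorm2 U \<omega> f'"
  unfolding wnorm2_def by (rule nn_integral_cong) (auto simp: indicator_def assms)

lemma winner_lincomb:
  assumes "continuous_on U f" "wnorm2 U \<omega> f < \<infinity>" "continuous_on U g" "wnorm2 U \<omega> g < \<infinity>"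
    "continuous_on U h" "wnorm2 U \<omega> h < \<infinity>"
  shows "winner U \<omega> (\<lambda>z. a * f z + b * g z) h = a * winner U \<omega> f h + b * winner U \<omega> g h"
proof -
  note fh = winner_integrable[OF assms(1,2,5,6), unfolded set_integrable_def]
    and gh = winner_integrable[OF assms(3-6), unfolded set_integrable_def]
  have "winner U \<omega> (\<lambda>z. a * f z + b * g z) h
      = (\<integral>z. a * (indicator U z *\<^sub>R (f z * cnj (h z) * of_real (\<omega> z)))
            + b * (indicator U z *\<^sub>R (g z * cnj (h z) * of_real (\<omega> z))) \<partial>lborel)"
    unfolding winner_def set_lebesgue_integral_def
    by (rule Bochner_Integration.integral_cong) (auto simp: indicator_def algebra_simps)
  also have "\<dots> = a * winner U \<omega> f h + b * winner U \<omega> g h"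
    unfolding winner_def set_lebesgue_integral_def
    by (subst Bochner_Integration.integral_add[OF integrable_mult_right[OF fh] integrable_mult_right[OF gh]])
       (simp only: integral_mult_right_zero)
  finally show ?thesis .
qed

lemma wnorm2_lincomb_finite:
  assumes f: "continuous_on U f" "wnorm2 U \<omega> f < \<infinity>" and g: "continuous_on U g" "wnorm2 U \<omega> g < \<infinity>"
  shows "wnorm2 U \<omega> (\<lambda>z. a * f z + b * g z) < \<infinity>"
proof -
  let ?F = "\<lambda>f z. ennreal ((cmod (f z))\<^sup>2 * \<omega> z) * indicator U z"
  have "wnorm2 U \<omega> (\<lambda>z. a * f z + b * g z)
      \<le> (\<integral>\<^sup>+z. ennreal (2 * (cmod a)\<^sup>2) * ?F f z + ennreal (2 * (cmod b)\<^sup>2) * ?F g z \<partial>lborel)"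
    unfolding wnorm2_def
  proof (rule nn_integral_mono)
    fix z
    show "?F (\<lambda>z. a * f z + b * g z) z \<le> ennreal (2 * (cmod a)\<^sup>2) * ?F f z + ennreal (2 * (cmod b)\<^sup>2) * ?F g z"
    proof (cases "z \<in> U")
      case True
      have "(cmod (a * f z + b * g z))\<^sup>2 \<le> (cmod (a * f z) + cmod (b * g z))\<^sup>2"
        by (intro power_mono norm_triangle_ineq) simp
      also have "\<dots> \<le> 2 * (cmod (a * f z))\<^sup>2 + 2 * (cmod (b * g z))\<^sup>2"
        using sum_squares_bound[of "cmod (a * f z)" "cmod (b * g z)"] by (simp add: power2_sum)
      also have "\<dots> = 2 * (cmod a)\<^sup>2 * (cmod (f z))\<^sup>2 + 2 * (cmod b)\<^sup>2 * (cmod (g z))\<^sup>2"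
        by (simp add: norm_mult power_mult_distrib)
      finally have "(cmod (a * f z + b * g z))\<^sup>2 * \<omega> z
          \<le> (2 * (cmod a)\<^sup>2 * (cmod (f z))\<^sup>2 + 2 * (cmod b)\<^sup>2 * (cmod (g z))\<^sup>2) * \<omega> z"
        using weight_pos[OF True] by (intro mult_right_mono) auto
      then have "ennreal ((cmod (a * f z + b * g z))\<^sup>2 * \<omega> z)
          \<le> ennreal (2 * (cmod a)\<^sup>2 * ((cmod (f z))\<^sup>2 * \<omega> z) + 2 * (cmod b)\<^sup>2 * ((cmod (g z))\<^sup>2 * \<omega> z))"
        by (intro ennreal_leI) (simp add: algebra_simps)
      also have "\<dots> = ennreal (2 * (cmod a)\<^sup>2) * ennreal ((cmod (f z))\<^sup>2 * \<omega> z)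
          + ennreal (2 * (cmod b)\<^sup>2) * ennreal ((cmod (g z))\<^sup>2 * \<omega> z)"
        using weight_pos[OF True] by (simp only: ennreal_plus ennreal_mult' mult_nonneg_nonneg zero_le_power2 zero_le_numeral less_imp_le)
      finally show ?thesis using True by simp
    qed simp
  qed
  also have "\<dots> = ennreal (2 * (cmod a)\<^sup>2) * wnorm2 U \<omega> f + ennreal (2 * (cmod b)\<^sup>2) * wnorm2 U \<omega> g"
    unfolding wnorm2_def using measurable_wnorm2[OF f(1)] measurable_wnorm2[OF g(1)]
    by (simp add: nn_integral_add nn_integral_cmult)
  also have "\<dots> < \<infinity>"
    using f(2) g(2) by (simp add: ennreal_mult_less_top)
  finally show ?thesis .
qed

section \<open>The Dirichlet inner product and its quadratic form\<close>

abbreviation D :: "(complex ^ 'n \<Rightarrow> complex) set" where "D \<equiv> dspace U \<omega> m"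
abbreviation inn (\<open>\<langle>_,_\<rangle>\<close>) where "\<langle>f,g\<rangle> \<equiv> dinner U \<omega> m f g"

text \<open>This is the square of the norm. The real part yields a real number before the form is
  known to be real on the diagonal.\<close>

definition nrm :: "(complex ^ 'n \<Rightarrow> complex) \<Rightarrow> real" where "nrm f = Re \<langle>f,f\<rangle>"

lemma D_holo: "f \<in> D \<Longrightarrow> holo_on U f"
  by (simp add: dspace_def)

lemma continuous_taylor_part: "continuous_on U (taylor_part m f)"
  by (intro holo_on_imp_continuous_on holo_on_taylor_part open_U)

lemma continuous_Dmulti: "holo_on U f \<Longrightarrow> continuous_on U (Dmulti l f)"
  by (intro holo_on_imp_continuous_on holo_on_Dmulti)

text \<open>The coefficients \<open>fact m / mfact l\<close> are positive and finitely many, so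
  finiteness of the weighted sum splits into finiteness of every piece.\<close>

lemma D_iff:
  "f \<in> D \<longleftrightarrow> holo_on U f \<and> wnorm2 U \<omega> (taylor_part m f) < \<infinity> \<and> (\<forall>l. mabs l = m \<longrightarrow> wnorm2 U \<omega> (Dmulti l f) < \<infinity>)"
proof -
  have "ennreal (fact m / mfact l) * x < \<infinity> \<longleftrightarrow> x < \<infinity>" for l :: "'n \<Rightarrow> nat" and x
    using mfact_pos[of l] by (auto simp: ennreal_mult_less_top)
  then show ?thesis
    unfolding dspace_def dnorm2_def by (auto simp: finite_mabs_eq)
qed

lemma D_lincomb:
  assumes f: "f \<in> D" and g: "g \<in> D"
  shows "(\<lambda>z. a * f z + b * g z) \<in> D"
  unfolding D_iff
proof (intro conjI allI impI)
  note hf = D_holo[OF f] and hg = D_holo[OF g]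
  show "holo_on U (\<lambda>z. a * f z + b * g z)" by (rule holo_on_lincomb(1)[OF hf hg])
  show "wnorm2 U \<omega> (taylor_part m (\<lambda>z. a * f z + b * g z)) < \<infinity>"
    unfolding taylor_part_lincomb[OF hf hg zero_in_U, abs_def]
    by (intro wnorm2_lincomb_finite continuous_taylor_part) (use f g in \<open>auto simp: D_iff\<close>)
  fix l :: "'n \<Rightarrow> nat" assume l: "mabs l = m"
  have "wnorm2 U \<omega> (Dmulti l (\<lambda>z. a * f z + b * g z)) = wnorm2 U \<omega> (\<lambda>z. a * Dmulti l f z + b * Dmulti l g z)"
    by (rule wnorm2_cong) (rule Dmulti_lincomb[OF hf hg])
  also have "\<dots> < \<infinity>"
    by (intro wnorm2_lincomb_finite continuous_Dmulti hf hg) (use f g l in \<open>auto simp: D_iff\<close>)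
  finally show "wnorm2 U \<omega> (Dmulti l (\<lambda>z. a * f z + b * g z)) < \<infinity>" .
qed

lemma inn_lincomb:
  assumes f: "f \<in> D" and g: "g \<in> D" and h: "h \<in> D"
  shows "\<langle>\<lambda>z. a * f z + b * g z, h\<rangle> = a * \<langle>f,h\<rangle> + b * \<langle>g,h\<rangle>"
proof -
  note hf = D_holo[OF f] and hg = D_holo[OF g] and hh = D_holo[OF h]
  have 1: "winner U \<omega> (taylor_part m (\<lambda>z. a * f z + b * g z)) (taylor_part m h)
      = a * winner U \<omega> (taylor_part m f) (taylor_part m h) + b * winner U \<omega> (taylor_part m g) (taylor_part m h)"
    unfolding taylor_part_lincomb[OF hf hg zero_in_U, abs_def]
    by (intro winner_lincomb continuous_taylor_part) (use f g h in \<open>auto simp: D_iff\<close>)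
  have 2: "winner U \<omega> (Dmulti l (\<lambda>z. a * f z + b * g z)) (Dmulti l h)
      = a * winner U \<omega> (Dmulti l f) (Dmulti l h) + b * winner U \<omega> (Dmulti l g) (Dmulti l h)"
    if "mabs l = m" for l
  proof -
    have "winner U \<omega> (Dmulti l (\<lambda>z. a * f z + b * g z)) (Dmulti l h)
        = winner U \<omega> (\<lambda>z. a * Dmulti l f z + b * Dmulti l g z) (Dmulti l h)"
      by (rule winner_cong) (simp_all add: Dmulti_lincomb[OF hf hg])
    also have "\<dots> = a * winner U \<omega> (Dmulti l f) (Dmulti l h) + b * winner U \<omega> (Dmulti l g) (Dmulti l h)"
      by (intro winner_lincomb continuous_Dmulti hf hg hh) (use f g h that in \<open>auto simp: D_iff\<close>)
    finally show ?thesis .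
  qed
  let ?c = "\<lambda>l. complex_of_real (fact m / mfact l)"
  have "(\<Sum>l\<in>{l. mabs l = m}. ?c l * winner U \<omega> (Dmulti l (\<lambda>z. a * f z + b * g z)) (Dmulti l h))
      = (\<Sum>l\<in>{l. mabs l = m}. a * (?c l * winner U \<omega> (Dmulti l f) (Dmulti l h))
          + b * (?c l * winner U \<omega> (Dmulti l g) (Dmulti l h)))"
    by (rule sum.cong[OF refl]) (simp only: mem_Collect_eq 2 distrib_left mult_ac)
  then show ?thesis
    unfolding dinner_def 1 by (simp only: sum.distrib sum_distrib_left[symmetric] distrib_left add_ac)
qed

lemma inn_cnj: "\<langle>g,f\<rangle> = cnj \<langle>f,g\<rangle>"
  unfolding dinner_def winner_cnj[of "taylor_part m g"] winner_cnj[of "Dmulti _ g"] by simp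

lemma nrm:
  assumes "f \<in> D"
  shows "0 \<le> nrm f" and "\<langle>f,f\<rangle> = of_real (nrm f)" and "dnorm2 U \<omega> m f = ennreal (nrm f)"
proof -
  note w0 = winner_self[OF continuous_taylor_part, of f]
  note wl = winner_self[OF continuous_Dmulti[OF D_holo[OF assms]]]
  have fin: "wnorm2 U \<omega> (taylor_part m f) < \<infinity>" "\<And>l. mabs l = m \<Longrightarrow> wnorm2 U \<omega> (Dmulti l f) < \<infinity>"
    using assms by (auto simp: D_iff)
  have c: "0 \<le> fact m / mfact l" for l :: "'n \<Rightarrow> nat" using mfact_pos[of l] by simp
  have re: "nrm f = Re (winner U \<omega> (taylor_part m f) (taylor_part m f))
      + (\<Sum>l\<in>{l. mabs l = m}. fact m / mfact l * Re (winner U \<omega> (Dmulti l f) (Dmulti l f)))"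
    unfolding nrm_def dinner_def by (simp del: of_real_divide)
  have term_nn: "0 \<le> fact m / mfact l * Re (winner U \<omega> (Dmulti l f) (Dmulti l f))" if "mabs l = m" for l
    by (intro mult_nonneg_nonneg c wl(2) fin(2) that)
  then have nn: "0 \<le> (\<Sum>l\<in>{l. mabs l = m}. fact m / mfact l * Re (winner U \<omega> (Dmulti l f) (Dmulti l f)))"
    by (intro sum_nonneg) blast
  show "0 \<le> nrm f" using nn w0(2)[OF fin(1)] by (simp add: re)
  have "Im \<langle>f,f\<rangle> = 0"
    using w0(1)[OF fin(1)] wl(1)[OF fin(2)] unfolding dinner_def by (simp del: of_real_divide)
  then show "\<langle>f,f\<rangle> = of_real (nrm f)" by (simp add: nrm_def complex_eq_iff)
  have "dnorm2 U \<omega> m f = ennreal (Re (winner U \<omega> (taylor_part m f) (taylor_part m f)))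
      + (\<Sum>l\<in>{l. mabs l = m}. ennreal (fact m / mfact l * Re (winner U \<omega> (Dmulti l f) (Dmulti l f))))"
    unfolding dnorm2_def w0(3)[OF fin(1)]
    by (intro arg_cong2[where f = "(+)"] sum.cong refl) (use wl(3)[OF fin(2)] ennreal_mult''[OF wl(2)[OF fin(2)]] in \<open>simp del: times_divide_eq_left\<close>)
  also have "\<dots> = ennreal (nrm f)"
    unfolding re ennreal_plus[OF w0(2)[OF fin(1)] nn]
    by (intro arg_cong2[where f = "(+)"] refl sum_ennreal) (use term_nn in blast)
  finally show "dnorm2 U \<omega> m f = ennreal (nrm f)" .
qed

text \<open>The difference \<open>f - c g\<close> is spelled \<open>1 * f z + (- c) * g z\<close> so
  that the closure and linearity lemmas for \<open>a * f z + b * g z\<close> match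
  literally.\<close>

lemma nrm_diff:
  assumes f: "f \<in> D" and g: "g \<in> D"
  shows "nrm (\<lambda>z. 1 * f z + (- c) * g z) = nrm f - 2 * Re (cnj c * \<langle>f,g\<rangle>) + (cmod c)\<^sup>2 * nrm g"
proof -
  let ?h = "\<lambda>z. 1 * f z + (- c) * g z"
  have h: "?h \<in> D" by (rule D_lincomb[OF f g])
  have "\<langle>?h,?h\<rangle> = 1 * \<langle>f,?h\<rangle> + (- c) * \<langle>g,?h\<rangle>" by (rule inn_lincomb[OF f g h])
  moreover have "\<langle>f,?h\<rangle> = cnj (1 * \<langle>f,f\<rangle> + (- c) * \<langle>g,f\<rangle>)"
    using inn_lincomb[OF f g f, of 1 "-c"] inn_cnj[of f ?h] by simp
  moreover have "\<langle>g,?h\<rangle> = cnj (1 * \<langle>f,g\<rangle> + (- c) * \<langle>g,g\<rangle>)"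
    using inn_lincomb[OF f g g, of 1 "-c"] inn_cnj[of g ?h] by simp
  ultimately have "\<langle>?h,?h\<rangle> = 1 * cnj (1 * of_real (nrm f) + (- c) * cnj \<langle>f,g\<rangle>)
      + (- c) * cnj (1 * \<langle>f,g\<rangle> + (- c) * of_real (nrm g))"
    by (simp only: nrm(2)[OF f] nrm(2)[OF g] inn_cnj[of g f])
  then have "nrm ?h = Re (1 * cnj (1 * of_real (nrm f) + (- c) * cnj \<langle>f,g\<rangle>)
      + (- c) * cnj (1 * \<langle>f,g\<rangle> + (- c) * of_real (nrm g)))"
    by (simp only: nrm_def)
  then show ?thesis
    unfolding cmod_power2 by (simp add: algebra_simps power2_eq_square)
qed

text \<open>Choosing \<open>c = z / k\<close>, or letting \<open>c\<close> run through the multiples of \<open>z\<close> if \<open>k = 0\<close>.\<close>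

lemma quadratic_form_bound:
  fixes a k :: real and z :: complex
  assumes "\<And>c. 0 \<le> a - 2 * Re (cnj c * z) + (cmod c)\<^sup>2 * k" and "0 \<le> k"
  shows "(cmod z)\<^sup>2 \<le> a * k"
proof (cases "k = 0")
  case True
  have "2 * t * (cmod z)\<^sup>2 \<le> a" for t :: real
    using assms(1)[of "of_real t * z"] True unfolding cmod_power2 by (simp add: power2_eq_square algebra_simps)
  from this[of "(a + 1) / (2 * (cmod z)\<^sup>2)"] show ?thesis using True by (cases "z = 0") auto
next
  case False
  then have k: "k > 0" using assms(2) by simp
  have 1: "Re (cnj (z / of_real k) * z) = (cmod z)\<^sup>2 / k"
    unfolding cmod_power2 by (simp add: power2_eq_square add_divide_distrib)
  have 2: "(cmod (z / of_real k))\<^sup>2 * k = (cmod z)\<^sup>2 / k"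
    using k by (simp add: norm_divide power_divide power2_eq_square)
  have "0 \<le> a - (cmod z)\<^sup>2 / k" using assms(1)[of "z / of_real k", unfolded 1 2] by simp
  then show ?thesis using k by (simp add: field_simps)
qed

section \<open>Consequences of the reproducing property\<close>

context
  fixes K :: "complex ^ 'n \<Rightarrow> complex ^ 'n \<Rightarrow> complex"
  assumes K: "is_repr_kernel U \<omega> m K"
begin

lemma kernel_in_D: "w \<in> U \<Longrightarrow> (\<lambda>z. K z w) \<in> D"
  and reproducing: "w \<in> U \<Longrightarrow> f \<in> D \<Longrightarrow> \<langle>f, \<lambda>z. K z w\<rangle> = f w"
  using K by (auto simp: is_repr_kernel_def)

lemma nrm_kernel: "w \<in> U \<Longrightarrow> nrm (\<lambda>z. K z w) = Re (K w w)"
  unfolding nrm_def by (simp add: reproducing kernel_in_D)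

lemma kernel_diag_nonneg: "w \<in> U \<Longrightarrow> 0 \<le> Re (K w w)"
  using nrm(1)[OF kernel_in_D] nrm_kernel by simp

lemma kernel_hermitian: "z \<in> U \<Longrightarrow> w \<in> U \<Longrightarrow> K w z = cnj (K z w)"
  using inn_cnj[of "\<lambda>u. K u z" "\<lambda>u. K u w"] by (simp add: reproducing kernel_in_D)

text \<open>Cauchy-Schwarz for \<open>f\<close> and the kernel function at \<open>w\<close>: the
  squared norm of \<open>f - c K(_,w)\<close> is nonnegative for every \<open>c\<close>, and the
  reproducing property turns the mixed term into \<open>f w\<close>.\<close>

lemma evaluation_bound:
  assumes "f \<in> D" "w \<in> U"
  shows "(cmod (f w))\<^sup>2 \<le> nrm f * Re (K w w)"
proof (rule quadratic_form_bound)
  show "0 \<le> nrm f - 2 * Re (cnj c * f w) + (cmod c)\<^sup>2 * Re (K w w)" for c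
    using nrm(1)[OF D_lincomb[OF assms(1) kernel_in_D[OF assms(2)]], of 1 "-c"]
      nrm_diff[OF assms(1) kernel_in_D[OF assms(2)], of c]
    by (simp add: reproducing[OF assms(2,1)] nrm_kernel[OF assms(2)])
  show "0 \<le> Re (K w w)" by (rule kernel_diag_nonneg[OF assms(2)])
qed

lemma kernel_difference_bound:
  assumes f: "f \<in> D" and z: "z \<in> U" and w: "w \<in> U"
  shows "(cmod (f z - K z w))\<^sup>2 \<le> (nrm f - 2 * Re (f w) + Re (K w w)) * Re (K z z)"
  using evaluation_bound[OF D_lincomb[OF f kernel_in_D[OF w]] z, of 1 "-1"]
    nrm_diff[OF f kernel_in_D[OF w], of 1]
  by (simp add: reproducing[OF w f] nrm_kernel[OF w])

lemma kernel_bound: "z \<in> U \<Longrightarrow> w \<in> U \<Longrightarrow> (cmod (K z w))\<^sup>2 \<le> Re (K w w) * Re (K z z)"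
  using evaluation_bound[OF kernel_in_D] nrm_kernel by metis

end

end

section \<open>Local boundedness of point evaluations\<close>

lemma (in dirichlet_space) Bergman_bound:
  assumes "0 < s" "s < t" "cball 0 t \<subseteq> U"
  obtains \<kappa> where "\<kappa> > 0"
    "\<And>g B z. holo_on U g \<Longrightarrow> wnorm2 U \<omega> g \<le> ennreal B \<Longrightarrow> 0 \<le> B \<Longrightarrow> z \<in> ball 0 s \<Longrightarrow> (cmod (g z))\<^sup>2 \<le> \<kappa> * B"
proof -
  have "compact (cball (0 :: complex ^ 'n) t)" "cball (0 :: complex ^ 'n) t \<noteq> {}"
    using assms by auto
  from continuous_attains_inf[OF this continuous_on_subset[OF continuous_weight assms(3)]]
  obtain x where x: "x \<in> cball 0 t" "\<And>y. y \<in> cball 0 t \<Longrightarrow> \<omega> x \<le> \<omega> y" by blast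
  \<comment> \<open>\<open>c\<close> is the minimum of the weight on \<open>cball 0 t\<close>. A
    ball of radius \<open>t - s\<close> about a point of \<open>ball 0 s\<close> stays inside, so
    the unweighted mean value inequality loses only the factor \<open>c\<close>; with
    \<open>\<beta>\<close> the volume of that ball this gives
    \<open>1 / (c * \<beta>)\<close>.\<close>
  define c where "c = \<omega> x"
  have c: "c > 0" using x assms(3) weight_pos unfolding c_def by blast
  define \<rho> where "\<rho> = t - s"
  have \<rho>: "\<rho> > 0" using assms by (simp add: \<rho>_def)
  define \<beta> where "\<beta> = measure lborel (ball (0 :: complex ^ 'n) \<rho>)"
  have \<beta>: "\<beta> > 0" "emeasure lborel (ball (0 :: complex ^ 'n) \<rho>) = ennreal \<beta>"
    using content_ball_pos[OF \<rho>] emeasure_lborel_ball_finite[of "0 :: complex ^ 'n" \<rho>]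
    unfolding \<beta>_def by (auto simp: emeasure_eq_ennreal_measure)
  show ?thesis
  proof (rule that[of "1 / (c * \<beta>)"])
    show "1 / (c * \<beta>) > 0" using c \<beta> by simp
    fix g B and z :: "complex ^ 'n"
    assume g: "holo_on U g" and B: "wnorm2 U \<omega> g \<le> ennreal B" "0 \<le> B" and z: "z \<in> ball 0 s"
    have sub: "ball z \<rho> \<subseteq> cball 0 t"
    proof
      fix y assume "y \<in> ball z \<rho>"
      then show "y \<in> cball 0 t"
        using z norm_triangle_sub[of y z] by (simp add: \<rho>_def dist_norm norm_minus_commute)
    qed
    then have sub': "ball z \<rho> \<subseteq> U" using assms(3) by blast
    have "ennreal (c * \<beta> * (cmod (g z))\<^sup>2) = ennreal c * (ennreal ((cmod (g z))\<^sup>2) * emeasure lborel (ball (0 :: complex ^ 'n) \<rho>))"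
      using c \<beta> by (simp add: ennreal_mult mult_ac)
    also have "\<dots> \<le> ennreal c * (\<integral>\<^sup>+u. ennreal ((cmod (g u))\<^sup>2) * indicator (ball z \<rho>) u \<partial>lborel)"
      by (intro mult_left_mono holo_mean_value[OF g sub' \<rho>]) simp
    also have "\<dots> = (\<integral>\<^sup>+u. ennreal c * (ennreal ((cmod (g u))\<^sup>2) * indicator (ball z \<rho>) u) \<partial>lborel)"
    proof (rule nn_integral_cmult[symmetric])
      have "continuous_on (ball z \<rho>) (\<lambda>u. (cmod (g u))\<^sup>2)"
        by (intro continuous_intros continuous_on_subset[OF holo_on_imp_continuous_on[OF g] sub'])
      from borel_measurable_ennreal_on_open[OF open_ball this]
      show "(\<lambda>u. ennreal ((cmod (g u))\<^sup>2) * indicator (ball z \<rho>) u) \<in> borel_measurable lborel" by simp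
    qed
    also have "\<dots> \<le> wnorm2 U \<omega> g"
      unfolding wnorm2_def
    proof (rule nn_integral_mono)
      fix u
      show "ennreal c * (ennreal ((cmod (g u))\<^sup>2) * indicator (ball z \<rho>) u) \<le> ennreal ((cmod (g u))\<^sup>2 * \<omega> u) * indicator U u"
      proof (cases "u \<in> ball z \<rho>")
        case True
        then have u: "u \<in> U" "c \<le> \<omega> u" using sub sub' x unfolding c_def by blast+
        have "c * (cmod (g u))\<^sup>2 \<le> (cmod (g u))\<^sup>2 * \<omega> u"
          using mult_left_mono[OF u(2), of "(cmod (g u))\<^sup>2"] by (simp add: mult.commute)
        then show ?thesis using True u c by (simp add: ennreal_mult'[symmetric] ennreal_leI)
      qed simp
    qed
    also have "\<dots> \<le> ennreal B" by (rule B)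
    finally have "c * \<beta> * (cmod (g z))\<^sup>2 \<le> B" using B by (simp add: ennreal_le_iff)
    then show "(cmod (g z))\<^sup>2 \<le> 1 / (c * \<beta>) * B" using c \<beta> by (simp add: field_simps)
  qed
qed

lemma (in dirichlet_space) wnorm2_le_nrm:
  assumes "f \<in> D"
  shows "wnorm2 U \<omega> (taylor_part m f) \<le> ennreal (nrm f)"
    and "mabs l = m \<Longrightarrow> wnorm2 U \<omega> (Dmulti l f) \<le> ennreal (mfact l * nrm f)"
proof -
  show "wnorm2 U \<omega> (taylor_part m f) \<le> ennreal (nrm f)"
    unfolding nrm(3)[OF assms, symmetric] dnorm2_def by simp
  assume l: "mabs l = m"
  have "ennreal (fact m / mfact l) * wnorm2 U \<omega> (Dmulti l f)
      \<le> (\<Sum>l\<in>{l. mabs l = m}. ennreal (fact m / mfact l) * wnorm2 U \<omega> (Dmulti l f))"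
    by (rule member_le_sum) (use l in \<open>auto simp: finite_mabs_eq\<close>)
  also have "\<dots> \<le> ennreal (nrm f)"
    unfolding nrm(3)[OF assms, symmetric] dnorm2_def by simp
  finally have 1: "ennreal (fact m / mfact l) * wnorm2 U \<omega> (Dmulti l f) \<le> ennreal (nrm f)" .
  \<comment> \<open>Since \<open>fact m >= 1\<close>, multiplying the weighted term by
    \<open>mfact l\<close> already dominates the unweighted one; the sharper factor
    \<open>mfact l / fact m\<close> is given away.\<close>
  have "wnorm2 U \<omega> (Dmulti l f) = 1 * wnorm2 U \<omega> (Dmulti l f)" by simp
  also have "\<dots> \<le> ennreal (mfact l * (fact m / mfact l)) * wnorm2 U \<omega> (Dmulti l f)"
    using mfact_pos[of l] fact_ge_1[of m, where 'a = real]
    by (intro mult_right_mono) (simp_all add: ennreal_1[symmetric] del: ennreal_1)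
  also have "\<dots> = ennreal (mfact l) * (ennreal (fact m / mfact l) * wnorm2 U \<omega> (Dmulti l f))"
    using mfact_pos[of l] by (subst ennreal_mult) (simp_all add: mult.assoc)
  also have "\<dots> \<le> ennreal (mfact l) * ennreal (nrm f)"
    by (intro mult_left_mono 1) simp
  finally show "wnorm2 U \<omega> (Dmulti l f) \<le> ennreal (mfact l * nrm f)"
    using mfact_pos[of l] nrm(1)[OF assms] by (simp add: ennreal_mult)
qed

text \<open>All constants are obtained before \<open>f\<close> is fixed, with a choice over
  multi-indices for the Cauchy bounds. Uniformity in \<open>f\<close> is what makes the estimate
  applicable to kernel functions, which vary with their base point.\<close>

lemma (in dirichlet_space) evaluation_locally_bounded:
  assumes "0 < s" "s < t" "cball 0 t \<subseteq> U"
  obtains C where "\<And>f z. f \<in> D \<Longrightarrow> z \<in> ball 0 s \<Longrightarrow> (cmod (f z))\<^sup>2 \<le> C * nrm f"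
proof -
  obtain \<kappa> where \<kappa>: "\<kappa> > 0"
    "\<And>g B z. holo_on U g \<Longrightarrow> wnorm2 U \<omega> g \<le> ennreal B \<Longrightarrow> 0 \<le> B \<Longrightarrow> z \<in> ball 0 s \<Longrightarrow> (cmod (g z))\<^sup>2 \<le> \<kappa> * B"
    by (rule Bergman_bound[OF assms]) (rule that; assumption)
  have sU: "ball 0 s \<subseteq> U" using assms by (auto simp: subset_iff)
  have "\<forall>p. \<exists>C. \<forall>(g :: complex ^ 'n \<Rightarrow> complex) M. holo_on (ball 0 s) g \<longrightarrow>
      (\<forall>z\<in>ball 0 s. norm (g z) \<le> M) \<longrightarrow> norm (Dmulti p g 0) \<le> C * M"
    using Dmulti_Cauchy_bound[OF assms(1)] by blast
  then obtain Q where Q0: "\<forall>p (g :: complex ^ 'n \<Rightarrow> complex) M. holo_on (ball 0 s) g \<longrightarrow>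
      (\<forall>z\<in>ball 0 s. norm (g z) \<le> M) \<longrightarrow> norm (Dmulti p g 0) \<le> Q p * M"
    by (rule exE[OF choice])
  note Q = Q0[THEN spec, THEN spec, THEN spec, THEN mp, THEN mp]
  obtain C where C0: "\<forall>(f :: complex ^ 'n \<Rightarrow> complex) A. holo_on (ball 0 s) f \<longrightarrow>
      (\<forall>l. mabs l < m \<longrightarrow> norm (Dmulti l f 0) \<le> A) \<longrightarrow>
      (\<forall>l. mabs l = m \<longrightarrow> (\<forall>z\<in>ball 0 s. norm (Dmulti l f z) \<le> A)) \<longrightarrow>
      (\<forall>z\<in>ball 0 s. norm (f z) \<le> C * A)"
    using holo_bound_by_derivatives[OF assms(1)] by blast
  note C = C0[THEN spec, THEN spec, THEN mp, THEN mp, THEN mp, THEN bspec]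
  have nonneg: "0 \<le> \<kappa> * mfact l" for l :: "'n \<Rightarrow> nat"
    using \<kappa>(1) mfact_pos[of l] by simp
  \<comment> \<open>Sums over finite index sets serve as common upper bounds of their nonnegative
    terms; an empty set, as for \<open>m = 0\<close>, simply gives 0. The absolute value is there
    because the sign of \<open>Q p\<close> is unknown.\<close>
  define M1 where "M1 = (\<Sum>p\<in>{p :: 'n \<Rightarrow> nat. mabs p < m}. \<bar>Q p\<bar> * sqrt \<kappa>)"
  define M2 where "M2 = (\<Sum>l\<in>{l :: 'n \<Rightarrow> nat. mabs l = m}. sqrt (\<kappa> * mfact l))"
  have M1: "\<bar>Q p\<bar> * sqrt \<kappa> \<le> M1" if "mabs p < m" for p
    unfolding M1_def by (rule member_le_sum) (use that \<kappa> in \<open>auto simp: finite_mabs_less\<close>)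
  have M2: "sqrt (\<kappa> * mfact l) \<le> M2" if "mabs l = m" for l :: "'n \<Rightarrow> nat"
    unfolding M2_def by (rule member_le_sum) (use that nonneg in \<open>auto simp: finite_mabs_eq\<close>)
  have M0: "0 \<le> M1" "0 \<le> M2"
    unfolding M1_def M2_def using \<kappa>(1) nonneg by (auto intro!: sum_nonneg)
  show ?thesis
  proof (rule that)
    fix f z assume f: "f \<in> D" and z: "z \<in> ball (0 :: complex ^ 'n) s"
    define A where "A = sqrt (nrm f)"
    have A: "0 \<le> A" "A\<^sup>2 = nrm f" using nrm(1)[OF f] by (simp_all add: A_def)
    note hf = D_holo[OF f]
    have T: "norm (taylor_part m f y) \<le> sqrt \<kappa> * A" if "y \<in> ball 0 s" for y
      using \<kappa>(2)[OF holo_on_taylor_part[OF open_U] wnorm2_le_nrm(1)[OF f] nrm(1)[OF f] that]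
      by (simp add: real_le_rsqrt A_def real_sqrt_mult[symmetric])
    have "norm (f z) \<le> C * ((M1 + M2) * A)"
    proof (rule C[OF holo_on_subset[OF hf open_ball sU] _ _ z]; intro allI impI ballI)
      fix p :: "'n \<Rightarrow> nat" assume p: "mabs p < m"
      have "norm (Dmulti p f 0) = norm (Dmulti p (taylor_part m f) 0)"
        by (simp add: Dmulti_taylor_part[OF p])
      also have "\<dots> \<le> Q p * (sqrt \<kappa> * A)"
        by (rule Q[OF holo_on_taylor_part[OF open_ball] ballI[OF T]])
      also have "\<dots> \<le> \<bar>Q p\<bar> * (sqrt \<kappa> * A)"
        using A \<kappa>(1) by (intro mult_right_mono) auto
      also have "\<dots> = \<bar>Q p\<bar> * sqrt \<kappa> * A" by simp
      also have "\<dots> \<le> (M1 + M2) * A"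
        using M1[OF p] M0 A by (intro mult_right_mono) auto
      finally show "norm (Dmulti p f 0) \<le> (M1 + M2) * A" .
    next
      fix l :: "'n \<Rightarrow> nat" and y :: "complex ^ 'n" assume l: "mabs l = m" and y: "y \<in> ball 0 s"
      have nn: "0 \<le> mfact l * nrm f" using mfact_pos[of l] nrm(1)[OF f] by simp
      have "(cmod (Dmulti l f y))\<^sup>2 \<le> \<kappa> * (mfact l * nrm f)"
        by (rule \<kappa>(2)[OF holo_on_Dmulti[OF hf] wnorm2_le_nrm(2)[OF f l] nn y])
      then have "norm (Dmulti l f y) \<le> sqrt (\<kappa> * mfact l) * A"
        by (simp add: real_le_rsqrt A_def real_sqrt_mult[symmetric] mult.assoc)
      also have "\<dots> \<le> (M1 + M2) * A"
        using M2[OF l] M0 A by (intro mult_right_mono) auto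
      finally show "norm (Dmulti l f y) \<le> (M1 + M2) * A" .
    qed
    then have "(norm (f z))\<^sup>2 \<le> (C * ((M1 + M2) * A))\<^sup>2" by (rule power_mono) simp
    also have "\<dots> = (C * (M1 + M2))\<^sup>2 * nrm f"
      using A(2) by (simp add: power_mult_distrib mult.assoc)
    finally show "(cmod (f z))\<^sup>2 \<le> (C * (M1 + M2))\<^sup>2 * nrm f" .
  qed
qed

text \<open>Evaluating a kernel function at its own base point gives
  \<open>K(z,z)^2 <= C K(z,z)\<close>, since its squared norm is again \<open>K(z,z)\<close>. The
  value 0, where division fails, is absorbed by \<open>max C 0\<close>.\<close>

lemma (in dirichlet_space) kernel_locally_bounded:
  assumes K: "is_repr_kernel U \<omega> m K" and "0 < s" "s < t" "cball 0 t \<subseteq> U"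
  obtains C where "\<And>z. z \<in> ball 0 s \<Longrightarrow> Re (K z z) \<le> C"
proof -
  obtain C where C: "\<And>f z. f \<in> D \<Longrightarrow> z \<in> ball 0 s \<Longrightarrow> (cmod (f z))\<^sup>2 \<le> C * nrm f"
    by (rule evaluation_locally_bounded[OF assms(2-4)]) (rule that; assumption)
  show ?thesis
  proof (rule that)
    fix z :: "complex ^ 'n" assume z: "z \<in> ball 0 s"
    then have zU: "z \<in> U" using assms(3,4) by auto
    note nn = kernel_diag_nonneg[OF K zU]
    have "(Re (K z z))\<^sup>2 \<le> (cmod (K z z))\<^sup>2"
      using complex_Re_le_cmod nn by (intro power_mono) auto
    also have "\<dots> \<le> C * Re (K z z)"
      using C[OF kernel_in_D[OF K zU] z] nrm_kernel[OF K zU] by simp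
    finally have "Re (K z z) * Re (K z z) \<le> C * Re (K z z)" by (simp add: power2_eq_square)
    then show "Re (K z z) \<le> max C 0"
      using nn by (cases "Re (K z z) = 0") auto
  qed
qed

section \<open>Comparison of kernels on nested domains\<close>

lemma dnorm2_mono:
  assumes "U \<subseteq> V" "\<And>z. z \<in> U \<Longrightarrow> \<omega> z \<le> \<omega>' z"
  shows "dnorm2 U \<omega> m f \<le> dnorm2 V \<omega>' m f"
proof -
  \<comment> \<open>Taylor part and derivatives of \<open>f\<close> involve neither domain nor
    weight, so it is enough to compare the norms of one arbitrary function.\<close>
  have "wnorm2 U \<omega> g \<le> wnorm2 V \<omega>' g" for g
    unfolding wnorm2_def
    by (intro nn_integral_mono) (use assms in \<open>auto simp: indicator_def intro!: ennreal_leI mult_left_mono\<close>)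
  then show ?thesis unfolding dnorm2_def by (intro add_mono sum_mono mult_left_mono) auto
qed

text \<open>The squared norm of \<open>K'(_,w)\<close> over \<open>U\<close> is at most that over
  \<open>V\<close>, which is \<open>K'(w,w)\<close>, whereas its pairing over \<open>U\<close> with
  \<open>K(_,w)\<close> equals \<open>K'(w,w)\<close> exactly. The expansion is therefore at most
  \<open>K(w,w) - K'(w,w)\<close>, and its nonnegativity yields the monotonicity of the
  diagonal.\<close>

lemma kernel_compare:
  assumes sp: "dirichlet_space U \<omega>" "dirichlet_space V \<omega>'"
    and le: "U \<subseteq> V" "\<And>z. z \<in> U \<Longrightarrow> \<omega> z \<le> \<omega>' z"
    and K: "is_repr_kernel U \<omega> m K" "is_repr_kernel V \<omega>' m K'"
    and z: "z \<in> U" and w: "w \<in> U"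
  shows "Re (K' w w) \<le> Re (K w w)"
    and "(cmod (K' z w - K z w))\<^sup>2 \<le> (Re (K w w) - Re (K' w w)) * Re (K z z)"
proof -
  interpret A: dirichlet_space U \<omega> m by (rule sp)
  interpret B: dirichlet_space V \<omega>' m by (rule sp)
  let ?f = "\<lambda>u. K' u w"
  have wV: "w \<in> V" using w le by blast
  have fB: "?f \<in> dspace V \<omega>' m" by (rule B.kernel_in_D[OF K(2) wV])
  have mono: "dnorm2 U \<omega> m ?f \<le> dnorm2 V \<omega>' m ?f" by (rule dnorm2_mono[OF le])
  have fA: "?f \<in> dspace U \<omega> m"
    using fB mono holo_on_subset[OF _ A.open_U le(1)] unfolding dspace_def by auto
  have nf: "A.nrm ?f \<le> Re (K' w w)"
    using mono A.nrm(3)[OF fA] B.nrm(3)[OF fB] B.nrm(1)[OF fB] B.nrm_kernel[OF K(2) wV]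
    by (simp add: ennreal_le_iff)
  have "0 \<le> A.nrm ?f - 2 * Re (K' w w) + Re (K w w)"
    using A.nrm(1)[OF A.D_lincomb[OF fA A.kernel_in_D[OF K(1) w]], of 1 "-1"]
      A.nrm_diff[OF fA A.kernel_in_D[OF K(1) w], of 1]
    by (simp add: A.reproducing[OF K(1) w fA] A.nrm_kernel[OF K(1) w])
  then show "Re (K' w w) \<le> Re (K w w)" using nf by linarith
  have "(cmod (K' z w - K z w))\<^sup>2 \<le> (A.nrm ?f - 2 * Re (K' w w) + Re (K w w)) * Re (K z z)"
    by (rule A.kernel_difference_bound[OF K(1) fA z w])
  also have "\<dots> \<le> (Re (K w w) - Re (K' w w)) * Re (K z z)"
    using nf A.kernel_diag_nonneg[OF K(1) z] by (intro mult_right_mono) auto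
  finally show "(cmod (K' z w - K z w))\<^sup>2 \<le> (Re (K w w) - Re (K' w w)) * Re (K z z)" .
qed

text \<open>The pointwise limit inherits the Lipschitz constant, so convergence on a finite net of
  the compact set controls all its points.\<close>

lemma uniform_limit_equi_lipschitz:
  fixes f :: "'b \<Rightarrow> 'a::metric_space \<Rightarrow> 'c::metric_space"
  assumes S: "compact S" and F: "F \<noteq> bot" and C: "0 \<le> C"
    and lip: "\<forall>\<^sub>F i in F. \<forall>x\<in>S. \<forall>y\<in>S. dist (f i x) (f i y) \<le> C * dist x y"
    and lim: "\<And>x. x \<in> S \<Longrightarrow> ((\<lambda>i. f i x) \<longlongrightarrow> g x) F"
  shows "uniform_limit S f g F"
  unfolding uniform_limit_iff
proof (intro allI impI)
  fix e :: real assume e: "e > 0"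
  \<comment> \<open>\<open>C + 1\<close> avoids division by 0. Passing to a net point within
    \<open>d\<close> costs at most \<open>e / 4\<close> for \<open>f i\<close> and for
    \<open>g\<close>, and a further \<open>e / 4\<close> goes to convergence at the net
    point.\<close>
  define d where "d = e / (4 * (C + 1))"
  have d: "d > 0" "C * d \<le> e / 4" using e C by (auto simp: d_def field_simps)
  have glip: "dist (g x) (g y) \<le> C * dist x y" if "x \<in> S" "y \<in> S" for x y
  proof (rule tendsto_upperbound[OF tendsto_dist[OF lim[OF that(1)] lim[OF that(2)]] _ F])
    show "\<forall>\<^sub>F i in F. dist (f i x) (f i y) \<le> C * dist x y"
      using lip by eventually_elim (use that in blast)
  qed
  obtain T where T: "finite T" "T \<subseteq> S" "S \<subseteq> (\<Union>x\<in>T. ball x d)"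
    using compactE_image[OF S, of S "\<lambda>x. ball x d"] d(1) by (metis UN_I centre_in_ball open_ball subsetI)
  have "\<forall>\<^sub>F i in F. \<forall>x\<in>T. dist (f i x) (g x) < e / 4"
    by (rule eventually_ball_finite[OF T(1)]) (intro ballI tendstoD lim, use T(2) e in auto)
  with lip show "\<forall>\<^sub>F i in F. \<forall>x\<in>S. dist (f i x) (g x) < e"
  proof eventually_elim
    case (elim i)
    show ?case
    proof
      fix x assume x: "x \<in> S"
      then obtain y where y: "y \<in> T" "dist y x < d" using T(3) by auto
      then have yS: "y \<in> S" using T(2) by blast
      have "C * dist x y \<le> C * d" using y(2) C by (intro mult_left_mono) (auto simp: dist_commute)
      then have "C * dist x y \<le> e / 4" using d(2) by linarith
      then have "dist (f i x) (f i y) \<le> e / 4" "dist (g x) (g y) \<le> e / 4"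
        using elim(1) glip[OF x yS] x yS by (meson order_trans)+
      moreover have "dist (f i y) (g y) < e / 4" using elim(2) y(1) by blast
      moreover have "dist (f i x) (g x) \<le> dist (f i x) (f i y) + dist (f i y) (g y) + dist (g y) (g x)"
        by (meson dist_triangle dist_triangle2 order_trans add_right_mono dist_triangle_le add_mono_thms_linordered_semiring(3))
      ultimately show "dist (f i x) (g x) < e" using e by (simp add: dist_commute)
    qed
  qed
qed

section \<open>Weights and convergence of the kernels\<close>

definition ball_weight :: "real \<Rightarrow> real \<Rightarrow> complex ^ 'n::finite \<Rightarrow> real" where
  "ball_weight \<nu> R z = (1 - (norm z)\<^sup>2 / R\<^sup>2) powr (\<nu> * R\<^sup>2)"

definition Gauss_weight :: "real \<Rightarrow> complex ^ 'n::finite \<Rightarrow> real" where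
  "Gauss_weight \<nu> z = exp (- \<nu> * (norm z)\<^sup>2)"

lemma norm_sq_div_less_1:
  fixes z :: "'a::real_normed_vector"
  assumes "z \<in> ball 0 R" shows "(norm z)\<^sup>2 / R\<^sup>2 < 1"
proof -
  have "norm z < R" using assms by simp
  then have "(norm z)\<^sup>2 < R\<^sup>2" by (intro power_strict_mono) auto
  then show ?thesis by (metis divide_less_eq_1 zero_le_power2 le_less_trans)
qed

lemma dirichlet_space_ball:
  assumes "R > 0"
  shows "dirichlet_space (ball 0 R) (ball_weight \<nu> R :: complex ^ 'n::finite \<Rightarrow> real)"
proof
  show "continuous_on (ball 0 R) (ball_weight \<nu> R :: complex ^ 'n \<Rightarrow> real)"
    unfolding ball_weight_def
    using norm_sq_div_less_1[of _ R] assms by (intro continuous_intros) (force simp del: mem_ball)+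
  show "0 < ball_weight \<nu> R z" if "z \<in> ball 0 R" for z :: "complex ^ 'n"
    using norm_sq_div_less_1[OF that] unfolding ball_weight_def powr_gt_zero by linarith
qed (use assms in auto)

lemma dirichlet_space_Gauss: "dirichlet_space UNIV (Gauss_weight \<nu> :: complex ^ 'n::finite \<Rightarrow> real)"
  by unfold_locales (auto simp: Gauss_weight_def intro!: continuous_intros)

text \<open>This is \<open>ln (1 - t) <= - t\<close> for \<open>t = |z|^2 / R^2\<close>; the scaling
  of the exponent as \<open>\<nu> * R^2\<close> cancels the denominator of \<open>t\<close>.\<close>

lemma ball_weight_le_Gauss_weight:
  assumes "R > 0" "\<nu> > 0" "z \<in> ball 0 R"
  shows "ball_weight \<nu> R z \<le> Gauss_weight \<nu> z"
proof -
  let ?t = "(norm z)\<^sup>2 / R\<^sup>2"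
  have t: "?t < 1" by (rule norm_sq_div_less_1[OF assms(3)])
  have "ball_weight \<nu> R z = exp (\<nu> * R\<^sup>2 * ln (1 - ?t))"
    using t unfolding ball_weight_def powr_def by (subst if_not_P) (linarith, rule refl)
  also have "\<dots> \<le> exp (\<nu> * R\<^sup>2 * (- ?t))"
    using ln_le_minus_one[of "1 - ?t"] t assms by (intro exp_le_cancel_iff[THEN iffD2] mult_left_mono) auto
  also have "\<dots> = Gauss_weight \<nu> z" using assms by (simp add: Gauss_weight_def)
  finally show ?thesis .
qed

text \<open>Young's inequality \<open>a powr \<theta> \<le> \<theta> * a + (1 - \<theta>)\<close> with \<open>\<theta> = R\<^sup>2 / S\<^sup>2\<close>.\<close>

lemma ball_weight_mono:
  assumes R: "0 < R" "R \<le> S" and \<nu>: "\<nu> > 0" and z: "z \<in> ball 0 R"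
  shows "ball_weight \<nu> R z \<le> ball_weight \<nu> S z"
proof -
  define a where "a = 1 - (norm z)\<^sup>2 / R\<^sup>2"
  define \<theta> where "\<theta> = R\<^sup>2 / S\<^sup>2"
  have a: "a > 0" using norm_sq_div_less_1[OF z] by (simp add: a_def)
  have \<theta>: "0 \<le> \<theta>" "\<theta> \<le> 1" using R by (auto simp: \<theta>_def divide_le_eq_1 power_mono)
  have "a powr \<theta> \<le> \<theta> * a + (1 - \<theta>)"
    using Youngs_inequality_0[of \<theta> "1 - \<theta>" a 1] \<theta> a by simp
  also have "\<dots> = 1 - (norm z)\<^sup>2 / S\<^sup>2"
    using R by (simp add: a_def \<theta>_def field_simps)
  finally have "(a powr \<theta>) powr (\<nu> * S\<^sup>2) \<le> (1 - (norm z)\<^sup>2 / S\<^sup>2) powr (\<nu> * S\<^sup>2)"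
    using \<nu> by (intro powr_mono2) auto
  moreover have "(a powr \<theta>) powr (\<nu> * S\<^sup>2) = a powr (\<nu> * R\<^sup>2)"
    using R by (simp add: powr_powr \<theta>_def mult.commute)
  ultimately show ?thesis by (simp add: ball_weight_def a_def)
qed

lemma ball_weight_tendsto: "((\<lambda>R. ball_weight \<nu> R z) \<longlongrightarrow> Gauss_weight \<nu> z) at_top"
\<comment> \<open>The asymptotic limit is computed for positive \<open>x\<close>; at the origin both
  weights equal 1.\<close>
proof (cases "norm z = 0")
  case False
  define x where "x = (norm z)\<^sup>2"
  have "x > 0" using False by (simp add: x_def)
  then have "((\<lambda>R. (1 - x / R\<^sup>2) powr (\<nu> * R\<^sup>2)) \<longlongrightarrow> exp (- \<nu> * x)) at_top"
    by real_asymp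
  then show ?thesis by (simp add: ball_weight_def Gauss_weight_def x_def)
qed (simp add: ball_weight_def Gauss_weight_def)

text \<open>Collects all pieces of the squared norm, with the indicator of the domain, in one
  integrand over the whole space, so that Fatou's lemma applies once although the domains
  vary.\<close>

definition dnorm_density ::
  "(complex ^ 'n::finite) set \<Rightarrow> (complex ^ 'n \<Rightarrow> real) \<Rightarrow> nat \<Rightarrow> (complex ^ 'n \<Rightarrow> complex) \<Rightarrow> complex ^ 'n \<Rightarrow> ennreal" where
  "dnorm_density U \<omega> m f z = ennreal ((cmod (taylor_part m f z))\<^sup>2 * \<omega> z) * indicator U z
     + (\<Sum>l\<in>{l. mabs l = m}. ennreal (fact m / mfact l) * (ennreal ((cmod (Dmulti l f z))\<^sup>2 * \<omega> z) * indicator U z))"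

lemma (in dirichlet_space) nn_integral_dnorm_density:
  assumes "holo_on U f"
  shows "dnorm_density U \<omega> m f \<in> borel_measurable lborel"
    and "(\<integral>\<^sup>+z. dnorm_density U \<omega> m f z \<partial>lborel) = dnorm2 U \<omega> m f"
proof -
  note meas = measurable_wnorm2[OF continuous_taylor_part, of f] measurable_wnorm2[OF continuous_Dmulti[OF assms]]
  show "dnorm_density U \<omega> m f \<in> borel_measurable lborel"
    unfolding dnorm_density_def[abs_def]
    by (intro borel_measurable_add borel_measurable_sum borel_measurable_times_ennreal borel_measurable_const meas)
  have "(\<integral>\<^sup>+z. dnorm_density U \<omega> m f z \<partial>lborel) = wnorm2 U \<omega> (taylor_part m f)
      + (\<integral>\<^sup>+z. (\<Sum>l\<in>{l. mabs l = m}. ennreal (fact m / mfact l) * (ennreal ((cmod (Dmulti l f z))\<^sup>2 * \<omega> z) * indicator U z)) \<partial>lborel)"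
    unfolding dnorm_density_def wnorm2_def
    by (rule nn_integral_add) (intro borel_measurable_sum borel_measurable_times_ennreal borel_measurable_const meas)+
  also have "\<dots> = dnorm2 U \<omega> m f"
    unfolding dnorm2_def wnorm2_def
    by (simp only: nn_integral_sum[OF borel_measurable_times_ennreal[OF borel_measurable_const meas(2)]]
        nn_integral_cmult[OF meas(2)])
  finally show "(\<integral>\<^sup>+z. dnorm_density U \<omega> m f z \<partial>lborel) = dnorm2 U \<omega> m f" .
qed

section \<open>The kernels of the balls and of the Gaussian space\<close>

locale kernel_family =
  fixes \<nu> :: real and m :: nat
    and KR :: "real \<Rightarrow> complex ^ 'n::finite \<Rightarrow> complex ^ 'n \<Rightarrow> complex"
    and K :: "complex ^ 'n \<Rightarrow> complex ^ 'n \<Rightarrow> complex"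
  assumes \<nu>: "\<nu> > 0"
    and KR: "\<And>R. R > 0 \<Longrightarrow> is_repr_kernel (ball 0 R) (ball_weight \<nu> R) m (KR R)"
    and K: "is_repr_kernel UNIV (Gauss_weight \<nu>) m K"
begin

lemma KR_holo: "w \<in> ball 0 R \<Longrightarrow> holo_on (ball 0 R) (\<lambda>z. KR R z w)"
proof -
  assume w: "w \<in> ball 0 R"
  then have R: "R > 0" using norm_ge_zero[of w] by (simp del: norm_ge_zero)
  interpret dirichlet_space "ball 0 R" "ball_weight \<nu> R" m by (rule dirichlet_space_ball[OF R])
  show ?thesis by (rule D_holo[OF kernel_in_D[OF KR[OF R] w]])
qed

lemma KR_hermitian: "z \<in> ball 0 R \<Longrightarrow> w \<in> ball 0 R \<Longrightarrow> KR R w z = cnj (KR R z w)"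
proof -
  assume zw: "z \<in> ball 0 R" "w \<in> ball 0 R"
  then have R: "R > 0" using norm_ge_zero[of w] by (simp del: norm_ge_zero)
  interpret dirichlet_space "ball 0 R" "ball_weight \<nu> R" m by (rule dirichlet_space_ball[OF R])
  show ?thesis by (rule kernel_hermitian[OF KR[OF R] zw])
qed

lemma KR_bound: "z \<in> ball 0 R \<Longrightarrow> w \<in> ball 0 R \<Longrightarrow> (cmod (KR R z w))\<^sup>2 \<le> Re (KR R w w) * Re (KR R z z)"
proof -
  assume zw: "z \<in> ball 0 R" "w \<in> ball 0 R"
  then have R: "R > 0" using norm_ge_zero[of w] by (simp del: norm_ge_zero)
  interpret dirichlet_space "ball 0 R" "ball_weight \<nu> R" m by (rule dirichlet_space_ball[OF R])
  show ?thesis by (rule kernel_bound[OF KR[OF R] zw])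
qed

lemma K_diag_nonneg: "0 \<le> Re (K w w)"
proof -
  interpret dirichlet_space UNIV "Gauss_weight \<nu>" m by (rule dirichlet_space_Gauss)
  show ?thesis by (rule kernel_diag_nonneg[OF K]) simp
qed

lemma KR_compare:
  assumes "0 < R" "R \<le> S" "z \<in> ball 0 R" "w \<in> ball 0 R"
  shows "Re (KR S w w) \<le> Re (KR R w w)"
    and "(cmod (KR S z w - KR R z w))\<^sup>2 \<le> (Re (KR R w w) - Re (KR S w w)) * Re (KR R z z)"
proof -
  have S: "S > 0" "ball (0 :: complex ^ 'n) R \<subseteq> ball 0 S" using assms by auto
  note c = kernel_compare[OF dirichlet_space_ball[OF assms(1)] dirichlet_space_ball[OF S(1)] S(2)
      ball_weight_mono[OF assms(1,2) \<nu>] KR[OF assms(1)] KR[OF S(1)] assms(3,4)]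
  show "Re (KR S w w) \<le> Re (KR R w w)"
    "(cmod (KR S z w - KR R z w))\<^sup>2 \<le> (Re (KR R w w) - Re (KR S w w)) * Re (KR R z z)"
    by (rule c; assumption)+
qed

lemma KR_compare_K:
  assumes "0 < R" "z \<in> ball 0 R" "w \<in> ball 0 R"
  shows "Re (K w w) \<le> Re (KR R w w)"
    and "(cmod (K z w - KR R z w))\<^sup>2 \<le> (Re (KR R w w) - Re (K w w)) * Re (KR R z z)"
proof -
  note c = kernel_compare[OF dirichlet_space_ball[OF assms(1)] dirichlet_space_Gauss subset_UNIV
      ball_weight_le_Gauss_weight[OF assms(1) \<nu>] KR[OF assms(1)] K assms(2,3)]
  show "Re (K w w) \<le> Re (KR R w w)"
    "(cmod (K z w - KR R z w))\<^sup>2 \<le> (Re (KR R w w) - Re (K w w)) * Re (KR R z z)"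
    by (rule c; assumption)+
qed

text \<open>A bound at the single radius \<open>R0\<close> serves every larger one, because the
  diagonal values decrease in the radius.\<close>

lemma KR_diag_locally_bounded:
  assumes "0 < s" "s < R0"
  obtains C where "0 \<le> C" "\<And>R z. R0 \<le> R \<Longrightarrow> z \<in> ball 0 s \<Longrightarrow> Re (KR R z z) \<le> C"
proof -
  have R0: "R0 > 0" using assms by simp
  interpret dirichlet_space "ball 0 R0" "ball_weight \<nu> R0" m by (rule dirichlet_space_ball[OF R0])
  obtain C where C: "\<And>z. z \<in> ball 0 s \<Longrightarrow> Re (KR R0 z z) \<le> C"
    by (rule kernel_locally_bounded[OF KR[OF R0], of s "(s + R0) / 2"]) (use assms in auto)
  show ?thesis
  proof (rule that[of "max C 0"])
    fix R and z :: "complex ^ 'n" assume R: "R0 \<le> R" and z: "z \<in> ball 0 s"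
    then have "z \<in> ball 0 R0" using assms by simp
    then show "Re (KR R z z) \<le> max C 0"
      using KR_compare(1)[OF R0 R, of z z] C[OF z] by simp
  qed simp
qed

text \<open>The limit \<open>k\<close> of \<open>KR R _ w\<close> along integer radii belongs to the Bargmann--Dirichlet space by Fatou's lemma,
  with squared norm at most \<open>L = lim KR R w w = k w\<close>; the reproducing property of \<open>K\<close> then gives
  \<open>L\<^sup>2 \<le> L * K w w\<close>.\<close>

lemma diag_tendsto: "((\<lambda>R. Re (KR R w w)) \<longlongrightarrow> Re (K w w)) at_top"
proof -
  obtain N0 :: nat where N0: "norm w + 1 < real N0" using reals_Archimedean2 by blast
  \<comment> \<open>The shift by \<open>N0\<close> puts \<open>w\<close> into every ball of the
    sequence, so the diagonal values are monotone from the first term on.\<close>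
  define r where "r n = real (n + N0)" for n
  have r: "0 < r n" "w \<in> ball 0 (r n)" for n
    using N0 norm_ge_zero[of w] by (auto simp: r_def simp del: norm_ge_zero)
  have r_mono: "r a \<le> r b" if "a \<le> b" for a b using that by (simp add: r_def)
  have r_large: "\<exists>n. s < r n" for s
  proof -
    obtain n :: nat where "s < real n" using reals_Archimedean2 by blast
    then show ?thesis by (intro exI[of _ n]) (simp add: r_def)
  qed
  define f where "f n z = KR (r n) z w" for n z
  define \<phi> where "\<phi> n = Re (KR (r n) w w)" for n
  have \<phi>_dec: "\<phi> b \<le> \<phi> a" if "a \<le> b" for a b
    unfolding \<phi>_def by (rule KR_compare(1)[OF r(1) r_mono[OF that] r(2) r(2)])
  have \<phi>_ge: "Re (K w w) \<le> \<phi> n" for n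
    unfolding \<phi>_def by (rule KR_compare_K(1)[OF r(1) r(2) r(2)])
  have "decseq \<phi>" using \<phi>_dec by (simp add: decseq_def)
  then obtain L where L: "\<phi> \<longlonglongrightarrow> L" using decseq_convergent \<phi>_ge by blast
  have L_ge: "Re (K w w) \<le> L" by (rule LIMSEQ_le_const[OF L]) (use \<phi>_ge in blast)
  define k where "k z = lim (\<lambda>n. f n z)" for z
  have unif: "uniform_limit (ball 0 s) f k sequentially" if s: "s > 0" for s
  proof -
    obtain n0 where n0: "s < r n0" using r_large by blast
    obtain C where C: "0 \<le> C" "\<And>R z. r n0 \<le> R \<Longrightarrow> z \<in> ball 0 s \<Longrightarrow> Re (KR R z z) \<le> C"
      by (rule KR_diag_locally_bounded[OF s n0]) (rule that; assumption)
    have *: "(cmod (f b z - f a z))\<^sup>2 \<le> (\<phi> a - \<phi> b) * C" if "n0 \<le> a" "a \<le> b" "z \<in> ball 0 s" for a b z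
    proof -
      have z: "z \<in> ball 0 (r a)" using that n0 r_mono[OF that(1)] by simp
      have "(cmod (f b z - f a z))\<^sup>2 \<le> (\<phi> a - \<phi> b) * Re (KR (r a) z z)"
        unfolding f_def \<phi>_def by (rule KR_compare(2)[OF r(1) r_mono[OF that(2)] z r(2)])
      also have "\<dots> \<le> (\<phi> a - \<phi> b) * C"
        using \<phi>_dec[OF that(2)] C(2)[OF r_mono[OF that(1)] that(3)] by (intro mult_left_mono) auto
      finally show ?thesis .
    qed
    have "uniformly_Cauchy_on (ball 0 s) f"
    proof (rule uniformly_Cauchy_onI')
      fix e :: real assume e: "e > 0"
      \<comment> \<open>\<open>C + 1\<close> allows \<open>C = 0\<close> and makes
        \<open>d * C < e^2\<close> strict.\<close>
      define d where "d = e\<^sup>2 / (C + 1)"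
      have d: "d > 0" "d * C < e\<^sup>2" using e C(1) by (auto simp: d_def field_simps)
      have "\<forall>\<^sub>F n in sequentially. \<phi> n < L + d" using order_tendstoD(2)[OF L] d by simp
      then obtain M where M: "\<And>n. n \<ge> M \<Longrightarrow> \<phi> n < L + d" unfolding eventually_sequentially by blast
      have "dist (f a z) (f b z) < e" if z: "z \<in> ball 0 s" and ab: "max M n0 \<le> a" "a < b" for z a b
      proof -
        have "L \<le> \<phi> b" by (rule decseq_ge[OF \<open>decseq \<phi>\<close> L])
        then have "\<phi> a - \<phi> b \<le> d" using M[of a] ab by simp
        then have "(\<phi> a - \<phi> b) * C \<le> d * C" using C(1) by (intro mult_right_mono) auto
        then have "(cmod (f b z - f a z))\<^sup>2 < e\<^sup>2" using *[of a b z] z ab d(2) by simp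
        then have "cmod (f b z - f a z) < e" using e power2_less_imp_less by fastforce
        then show ?thesis by (simp add: dist_norm norm_minus_commute)
      qed
      then show "\<exists>M. \<forall>x\<in>ball 0 s. \<forall>m\<ge>M. \<forall>n>m. dist (f m x) (f n x) < e" by blast
    qed
    then have "uniformly_convergent_on (ball 0 s) f" by (rule Cauchy_uniformly_convergent)
    then show ?thesis unfolding uniformly_convergent_uniform_limit_iff k_def .
  qed
  have loc: "holo_on (ball 0 s) k \<and> (\<forall>l. \<forall>z\<in>ball 0 s. (\<lambda>n. Dmulti l (f n) z) \<longlonglongrightarrow> Dmulti l k z)" if s: "s > 0" for s
  proof -
    obtain n0 where n0: "s < r n0" using r_large by blast
    \<comment> \<open>Only from \<open>n0\<close> on are the terms known to be holomorphic on
      \<open>ball 0 s\<close>; Weierstrass's theorem is applied to the shifted sequence, and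
      \<open>LIMSEQ_offset\<close> returns to the original indexing.\<close>
    have holo: "holo_on (ball 0 s) (f (n + n0))" for n
    proof -
      have "ball (0 :: complex ^ 'n) s \<subseteq> ball 0 (r (n + n0))" using n0 r_mono[of n0 "n + n0"] by auto
      from holo_on_subset[OF KR_holo[OF r(2)] open_ball this] show ?thesis
        unfolding f_def[abs_def] .
    qed
    have "uniform_limit (ball 0 s) (\<lambda>n. f (n + n0)) k sequentially"
      using unif[OF s] unfolding uniform_limit_iff
      by (subst eventually_sequentially_seg) simp
    then have lu: "loc_unif (ball 0 s) (\<lambda>n. f (n + n0)) k" by (rule loc_unif_uniform_limit[OF open_ball])
    have "(\<lambda>n. Dmulti l (f n) z) \<longlonglongrightarrow> Dmulti l k z" if "z \<in> ball 0 s" for l z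
      using loc_unif_pointwise[OF loc_unif_Dmulti[OF open_ball holo lu] that] by (rule LIMSEQ_offset)
    then show ?thesis using loc_unif_holo(1)[OF open_ball holo lu] by blast
  qed
  have Dlim: "(\<lambda>n. Dmulti l (f n) z) \<longlonglongrightarrow> Dmulti l k z" for l z
    using loc[of "norm z + 1"] by (auto simp: add_nonneg_pos)
  have hk: "holo_on UNIV k"
  proof (rule holo_on_local[OF open_UNIV])
    fix z :: "complex ^ 'n"
    show "\<exists>V. z \<in> V \<and> holo_on V k"
      using loc[of "norm z + 1"] by (intro exI[of _ "ball 0 (norm z + 1)"]) (simp add: add_nonneg_pos)
  qed
  have flim: "(\<lambda>n. f n z) \<longlonglongrightarrow> k z" for z using Dlim[of "\<lambda>_. 0" z] by (simp add: Dmulti_0)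
  interpret F: dirichlet_space UNIV "Gauss_weight \<nu>" m by (rule dirichlet_space_Gauss)
  let ?E = "\<lambda>n. dnorm_density (ball 0 (r n)) (ball_weight \<nu> (r n)) m (f n)"
  let ?E' = "dnorm_density UNIV (Gauss_weight \<nu>) m k"
  have E: "?E n \<in> borel_measurable lborel" "(\<integral>\<^sup>+z. ?E n z \<partial>lborel) = ennreal (\<phi> n)" for n
  proof -
    interpret A: dirichlet_space "ball 0 (r n)" "ball_weight \<nu> (r n)" m by (rule dirichlet_space_ball[OF r(1)])
    have fD: "f n \<in> dspace (ball 0 (r n)) (ball_weight \<nu> (r n)) m"
      unfolding f_def[abs_def] by (rule A.kernel_in_D[OF KR[OF r(1)] r(2)])
    show "?E n \<in> borel_measurable lborel" by (rule A.nn_integral_dnorm_density(1)[OF A.D_holo[OF fD]])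
    have "(\<integral>\<^sup>+z. ?E n z \<partial>lborel) = ennreal (A.nrm (f n))"
      using A.nn_integral_dnorm_density(2)[OF A.D_holo[OF fD]] A.nrm(3)[OF fD] by simp
    also have "A.nrm (f n) = \<phi> n"
      unfolding f_def[abs_def] \<phi>_def by (rule A.nrm_kernel[OF KR[OF r(1)] r(2)])
    finally show "(\<integral>\<^sup>+z. ?E n z \<partial>lborel) = ennreal (\<phi> n)" .
  qed
  have r_top: "filterlim r at_top sequentially"
    unfolding r_def by (rule filterlim_compose[OF filterlim_real_sequentially filterlim_add_const_nat_at_top])
  have Elim: "(\<lambda>n. ?E n z) \<longlonglongrightarrow> ?E' z" for z
  proof -
    have wlim: "(\<lambda>n. ball_weight \<nu> (r n) z) \<longlonglongrightarrow> Gauss_weight \<nu> z"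
      by (rule filterlim_compose[OF ball_weight_tendsto r_top])
    have in_ball: "\<forall>\<^sub>F n in sequentially. norm z < r n"
      using r_top by (simp add: filterlim_at_top_dense)
    \<comment> \<open>For fixed \<open>z\<close> the indicator of \<open>ball 0 (r n)\<close> is
      eventually 1, so the growing domains disappear from the pointwise limit.\<close>
    have integrand: "(\<lambda>n. ennreal ((cmod (g n))\<^sup>2 * ball_weight \<nu> (r n) z) * indicator (ball 0 (r n)) z)
        \<longlonglongrightarrow> ennreal ((cmod g')\<^sup>2 * Gauss_weight \<nu> z) * indicator UNIV z" if "g \<longlonglongrightarrow> g'" for g g'
    proof (rule Lim_transform_eventually)
      show "(\<lambda>n. ennreal ((cmod (g n))\<^sup>2 * ball_weight \<nu> (r n) z)) \<longlonglongrightarrow> ennreal ((cmod g')\<^sup>2 * Gauss_weight \<nu> z) * indicator UNIV z"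
        by (simp, intro tendsto_ennrealI tendsto_intros that wlim)
      show "\<forall>\<^sub>F n in sequentially. ennreal ((cmod (g n))\<^sup>2 * ball_weight \<nu> (r n) z)
          = ennreal ((cmod (g n))\<^sup>2 * ball_weight \<nu> (r n) z) * indicator (ball 0 (r n)) z"
        using in_ball by eventually_elim simp
    qed
    show ?thesis
      unfolding dnorm_density_def
      by (intro tendsto_add tendsto_sum ennreal_tendsto_cmult integrand taylor_part_tendsto Dlim) simp_all
  qed
  have "dnorm2 UNIV (Gauss_weight \<nu>) m k = (\<integral>\<^sup>+z. liminf (\<lambda>n. ?E n z) \<partial>lborel)"
    unfolding F.nn_integral_dnorm_density(2)[OF hk, symmetric]
    by (intro nn_integral_cong) (simp add: lim_imp_Liminf[OF _ Elim])
  also have "\<dots> \<le> liminf (\<lambda>n. \<integral>\<^sup>+z. ?E n z \<partial>lborel)"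
    by (rule nn_integral_liminf) (rule E(1))
  also have "\<dots> = ennreal L"
    unfolding E(2) by (intro lim_imp_Liminf tendsto_ennrealI L) simp
  finally have le: "dnorm2 UNIV (Gauss_weight \<nu>) m k \<le> ennreal L" .
  then have kD: "k \<in> dspace UNIV (Gauss_weight \<nu>) m"
    using hk unfolding dspace_def by (auto intro: le_less_trans)
  have L0: "0 \<le> L" using L_ge K_diag_nonneg[of w] by simp
  have nk: "F.nrm k \<le> L" using le F.nrm(3)[OF kD] L0 by simp
  have "Re (k w) = L"
    using LIMSEQ_unique[OF tendsto_Re[OF flim[of w]]] L unfolding f_def \<phi>_def by blast
  then have "L\<^sup>2 \<le> (cmod (k w))\<^sup>2" using L0 complex_Re_le_cmod[of "k w"] by (intro power_mono) auto
  also have "\<dots> \<le> F.nrm k * Re (K w w)" by (rule F.evaluation_bound[OF K kD]) simp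
  also have "\<dots> \<le> L * Re (K w w)" using nk K_diag_nonneg[of w] by (intro mult_right_mono) auto
  finally have "L * L \<le> L * Re (K w w)" by (simp add: power2_eq_square)
  then have "L \<le> Re (K w w)" using L0 K_diag_nonneg[of w] by (cases "L = 0") auto
  then have L_eq: "L = Re (K w w)" using L_ge by simp
  \<comment> \<open>From integer radii to all radii: the lower bound holds for every
    \<open>R > norm w\<close>, and one integer radius with value below \<open>a\<close> controls all
    larger \<open>R\<close> by monotonicity.\<close>
  show ?thesis
  proof (rule order_tendstoI)
    fix a assume a: "a < Re (K w w)"
    have "\<forall>\<^sub>F R in at_top. norm w < R" by (rule eventually_gt_at_top)
    then show "\<forall>\<^sub>F R in at_top. a < Re (KR R w w)"
    proof eventually_elim
      case (elim R)
      then have "R > 0" "w \<in> ball 0 R" using norm_ge_zero[of w] by (auto simp del: norm_ge_zero)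
      then show ?case using KR_compare_K(1)[of R w w] a by simp
    qed
  next
    fix a assume "Re (K w w) < a"
    then have "\<forall>\<^sub>F n in sequentially. \<phi> n < a" using order_tendstoD(2)[OF L] L_eq by simp
    then obtain n where n: "\<phi> n < a" by (meson eventually_sequentially order_refl)
    have "\<forall>\<^sub>F R in at_top. r n \<le> R" by (rule eventually_ge_at_top)
    then show "\<forall>\<^sub>F R in at_top. Re (KR R w w) < a"
    proof eventually_elim
      case (elim R)
      then show ?case using KR_compare(1)[OF r(1) elim r(2) r(2)] n unfolding \<phi>_def by simp
    qed
  qed
qed

lemma pointwise_tendsto: "((\<lambda>R. KR R z w) \<longlongrightarrow> K z w) at_top"
proof -
  define s where "s = norm z + norm w + 1"
  have s: "s > 0" "z \<in> ball 0 s" "w \<in> ball 0 s" by (auto simp: s_def add_nonneg_pos)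
  obtain C where C: "0 \<le> C" "\<And>R z. s + 1 \<le> R \<Longrightarrow> z \<in> ball 0 s \<Longrightarrow> Re (KR R z z) \<le> C"
    by (rule KR_diag_locally_bounded[OF s(1), of "s + 1"]) auto
  have "((\<lambda>R. sqrt ((Re (KR R w w) - Re (K w w)) * C)) \<longlongrightarrow> sqrt ((Re (K w w) - Re (K w w)) * C)) at_top"
    by (intro tendsto_intros diag_tendsto)
  then have lim: "((\<lambda>R. sqrt ((Re (KR R w w) - Re (K w w)) * C)) \<longlongrightarrow> 0) at_top" by simp
  have "\<forall>\<^sub>F R in at_top. s + 1 \<le> R" by (rule eventually_ge_at_top)
  then have "\<forall>\<^sub>F R in at_top. norm (KR R z w - K z w) \<le> sqrt ((Re (KR R w w) - Re (K w w)) * C)"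
  proof eventually_elim
    case (elim R)
    then have R: "R > 0" "z \<in> ball 0 R" "w \<in> ball 0 R" using s by auto
    have "(cmod (K z w - KR R z w))\<^sup>2 \<le> (Re (KR R w w) - Re (K w w)) * Re (KR R z z)"
      by (rule KR_compare_K(2)[OF R])
    also have "\<dots> \<le> (Re (KR R w w) - Re (K w w)) * C"
      using KR_compare_K(1)[OF R(1) R(3) R(3)] C(2)[OF elim s(2)] by (intro mult_left_mono) auto
    finally show ?case by (simp add: real_le_rsqrt norm_minus_commute)
  qed
  from Lim_null_comparison[OF this lim] show ?thesis by (rule LIM_zero_cancel)
qed

text \<open>Holomorphy is at hand in the first variable only; the second is reached through
  Hermitian symmetry. The radii \<open>s\<close>, \<open>s + 1\<close>, \<open>s + 2\<close> leave
  room for Cauchy discs of radius 1/2 and for the diagonal bound. Each variable contributes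
  \<open>2 * C\<close>, hence \<open>4 * C\<close>.\<close>

lemma KR_lipschitz:
  assumes "s > 0"
  obtains C where "0 \<le> C"
    "\<And>R p q. s + 2 \<le> R \<Longrightarrow> p \<in> ball 0 s \<times> ball 0 s \<Longrightarrow> q \<in> ball 0 s \<times> ball 0 s \<Longrightarrow>
      dist (case p of (z, w) \<Rightarrow> KR R z w) (case q of (z, w) \<Rightarrow> KR R z w) \<le> C * dist p q"
proof -
  obtain C where C: "0 \<le> C" "\<And>R z. s + 2 \<le> R \<Longrightarrow> z \<in> ball 0 (s + 1) \<Longrightarrow> Re (KR R z z) \<le> C"
    by (rule KR_diag_locally_bounded[of "s + 1" "s + 2"]) (use assms in auto)
  have lip: "dist (KR R z w) (KR R z' w) \<le> 2 * C * dist z z'"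
    if R: "s + 2 \<le> R" and z: "z \<in> ball 0 s" "z' \<in> ball 0 s" and w: "w \<in> ball 0 s" for R z z' w
  proof -
    let ?g = "\<lambda>z. KR R z w"
    have sub: "ball 0 (s + 1) \<subseteq> ball (0 :: complex ^ 'n) R" using R by auto
    have w': "w \<in> ball 0 (s + 1)" "w \<in> ball 0 R" using w R by auto
    have g: "holo_on (ball 0 (s + 1)) ?g"
      by (rule holo_on_subset[OF KR_holo[OF w'(2)] open_ball sub])
    \<comment> \<open>By Cauchy-Schwarz off-diagonal values are dominated by diagonal ones, so the
      diagonal bound \<open>C\<close> also bounds the modulus.\<close>
    have gb: "norm (?g y) \<le> C" if "y \<in> ball 0 (s + 1)" for y
    proof -
      have y: "y \<in> ball 0 R" using that sub by blast
      have "0 \<le> Re (KR R y y)" using KR_compare_K(1)[of R y y] K_diag_nonneg[of y] y assms R by simp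
      moreover have "0 \<le> Re (KR R w w)" using KR_compare_K(1)[of R w w] K_diag_nonneg[of w] w' assms R by simp
      ultimately have "Re (KR R w w) * Re (KR R y y) \<le> C * C"
        using C(2)[OF R that] C(2)[OF R w'(1)] C(1) by (intro mult_mono) auto
      then have "(cmod (KR R y w))\<^sup>2 \<le> C\<^sup>2" using KR_bound[OF y w'(2)] by (simp add: power2_eq_square)
      then show ?thesis using C(1) by (rule power2_le_imp_le)
    qed
    have "norm (?g z - ?g z') \<le> 2 * C * norm (z - z')"
    proof (rule differentiable_bound[OF convex_ball])
      fix y :: "complex ^ 'n" assume y: "y \<in> ball 0 s"
      have y': "y \<in> ball 0 (s + 1)" using y by simp
      show "(?g has_derivative frechet_derivative ?g (at y)) (at y within ball 0 s)"
        by (rule has_derivative_at_withinI[OF holo_on_has_derivative(1)[OF g y']])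
      have c: "cball y (1/2) \<subseteq> ball 0 (s + 1)"
      proof
        fix x assume "x \<in> cball y (1/2)"
        then show "x \<in> ball 0 (s + 1)"
          using y norm_triangle_sub[of x y] by (simp add: dist_norm norm_minus_commute)
      qed
      have "norm (frechet_derivative ?g (at y) v) \<le> C / (1/2) * norm v" for v
        by (rule frechet_Cauchy_bound[OF g c]) (use gb c in auto)
      then show "onorm (frechet_derivative ?g (at y)) \<le> 2 * C"
        by (intro onorm_le) (simp add: mult_ac)
    qed (use z in auto)
    then show ?thesis by (simp add: dist_norm)
  qed
  show ?thesis
  proof (rule that[of "4 * C"])
    show "0 \<le> 4 * C" using C by simp
    fix R and p q :: "(complex ^ 'n) \<times> (complex ^ 'n)"
    assume R: "s + 2 \<le> R" and pq: "p \<in> ball 0 s \<times> ball 0 s" "q \<in> ball 0 s \<times> ball 0 s"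
    obtain z w z' w' where p: "p = (z, w)" and q: "q = (z', w')" by (cases p, cases q)
    have in_s: "z \<in> ball 0 s" "w \<in> ball 0 s" "z' \<in> ball 0 s" "w' \<in> ball 0 s" using pq p q by auto
    then have in_R: "w \<in> ball 0 R" "z' \<in> ball 0 R" "w' \<in> ball 0 R" using R by auto
    have "dist (KR R z w) (KR R z' w') \<le> dist (KR R z w) (KR R z' w) + dist (KR R z' w) (KR R z' w')"
      by (rule dist_triangle)
    also have "dist (KR R z' w) (KR R z' w') = dist (KR R w z') (KR R w' z')"
      using KR_hermitian[OF in_R(2,1)] KR_hermitian[OF in_R(2,3)]
      by (simp add: dist_norm flip: complex_cnj_diff)
    also have "dist (KR R z w) (KR R z' w) + \<dots> \<le> 2 * C * dist z z' + 2 * C * dist w w'"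
      by (intro add_mono lip R in_s)
    also have "\<dots> \<le> 2 * C * dist p q + 2 * C * dist p q"
      using C(1) dist_fst_le[of p q] dist_snd_le[of p q] p q
      by (intro add_mono mult_left_mono) auto
    finally show "dist (case p of (z, w) \<Rightarrow> KR R z w) (case q of (z, w) \<Rightarrow> KR R z w) \<le> 4 * C * dist p q"
      using p q by simp
  qed
qed

lemma uniform_tendsto:
  assumes S: "compact S"
  shows "uniform_limit S (\<lambda>R (z, w). KR R z w) (\<lambda>(z, w). K z w) at_top"
proof -
  obtain b where b: "b > 0" "\<And>p. p \<in> S \<Longrightarrow> norm p \<le> b"
    using compact_imp_bounded[OF S] by (auto simp: bounded_pos)
  define s where "s = b + 1"
  have s: "s > 0" using b by (simp add: s_def)
  have sub: "S \<subseteq> ball 0 s \<times> ball 0 s"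
  proof
    fix p assume "p \<in> S"
    then have "norm p < s" using b(2)[of p] by (simp add: s_def)
    then show "p \<in> ball 0 s \<times> ball 0 s"
      using norm_fst_le[of "fst p" "snd p"] norm_snd_le[of "snd p" "fst p"] by (cases p) auto
  qed
  obtain C where C: "0 \<le> C"
    "\<And>R p q. s + 2 \<le> R \<Longrightarrow> p \<in> ball 0 s \<times> ball 0 s \<Longrightarrow> q \<in> ball 0 s \<times> ball 0 s \<Longrightarrow>
      dist (case p of (z, w) \<Rightarrow> KR R z w) (case q of (z, w) \<Rightarrow> KR R z w) \<le> C * dist p q"
    by (rule KR_lipschitz[OF s]) (rule that; assumption)
  show ?thesis
  proof (rule uniform_limit_equi_lipschitz[OF S _ C(1)])
    have "\<forall>\<^sub>F R in at_top. s + 2 \<le> R" by (rule eventually_ge_at_top)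
    then show "\<forall>\<^sub>F R in at_top. \<forall>p\<in>S. \<forall>q\<in>S.
        dist (case p of (z, w) \<Rightarrow> KR R z w) (case q of (z, w) \<Rightarrow> KR R z w) \<le> C * dist p q"
      by eventually_elim (intro ballI C(2) subsetD[OF sub])
    show "((\<lambda>R. case p of (z, w) \<Rightarrow> KR R z w) \<longlongrightarrow> (case p of (z, w) \<Rightarrow> K z w)) at_top" for p
      by (cases p) (simp add: pointwise_tendsto)
  qed simp
qed

end

text \<open>\<open>KR R\<close> is a total function with unconstrained values off the ball; limits
  along \<open>at_top\<close> see only radii so large that the points in question lie in the
  ball.\<close>

theorem theorem3:
  fixes \<nu> :: real and m :: nat
    and KR :: "real \<Rightarrow> complex ^ 'n::finite \<Rightarrow> complex ^ 'n \<Rightarrow> complex"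
    and K :: "complex ^ 'n \<Rightarrow> complex ^ 'n \<Rightarrow> complex"
  assumes "\<nu> > 0"
    and "\<And>R. R > 0 \<Longrightarrow>
           is_repr_kernel (ball 0 R) (\<lambda>z. (1 - (norm z)\<^sup>2 / R\<^sup>2) powr (\<nu> * R\<^sup>2)) m (KR R)"
    and "is_repr_kernel UNIV (\<lambda>z. exp (- \<nu> * (norm z)\<^sup>2)) m K"
  shows "(\<forall>z w. ((\<lambda>R. KR R z w) \<longlongrightarrow> K z w) at_top)
       \<and> (\<forall>S. compact S \<longrightarrow> uniform_limit S (\<lambda>R (z, w). KR R z w) (\<lambda>(z, w). K z w) at_top)"
proof -
  interpret kernel_family \<nu> m KR K
    using assms by unfold_locales (simp_all add: ball_weight_def[abs_def] Gauss_weight_def[abs_def])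
  show ?thesis using pointwise_tendsto uniform_tendsto by blast
qed

end
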